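(* Let $A=\Bbbk Q/I$ be a string or locally string algebra over a field $\Bbbk$ with $A\not\cong\Bbbk[x]$, and let $\phi\in\operatorname{Aut}_0(A)$. For each $\alpha\in Q_1$ let $y_\alpha\in A_{>1}$ be a linear combination of maximal paths parallel to $\alpha$ such that $\phi(\alpha)\in y_\alpha+\langle\alpha\rangle$. Then $\delta:=-\sum_{\alpha\in Q_1}\delta_{(\alpha,y_\alpha)}$ is a derivation of type II and $(\exp(\delta)\circ\phi)(\alpha)\in\langle\alpha\rangle$ for every $\alpha\in Q_1$.
   Context: Quivers $Q=(Q_0,Q_1,s,t)$ are finite, connected, with at least one arrow. A path of length $\ell(p)=n\ge 1$ is $p=\alpha_1\cdots\alpha_n$ with $\alpha_i\in Q_1$, $t(\alpha_i)=s(\alpha_{i+1})$; $F(p)=\alpha_1$, $L(p)=\alpha_n$, $s(p)=s(\alpha_1)$, $t(p)=t(\alpha_n)$. For each vertex $v$ there is a stationary path $\epsilon_v$ of length $0$, with $F(\epsilon_v)=L(\epsilon_v)=\epsilon_v$. Paths are parallel if they have the same source and the same target. $\Bbbk Q$ is the path algebra (product = concatenation). $A=\Bbbk Q/I$ is a string algebra if: (i) every vertex has in-degree $\le 2$ and out-degree $\le 2$; (ii) whenever $s(\alpha)=t(\beta)=t(\beta')$ with $\beta\ne\beta'$ arrows, at least one of $\beta\alpha,\beta'\alpha$ is in $I$; (iii) whenever $t(\alpha)=s(\beta)=s(\beta')$ with $\beta\neq\beta'$, at least one of $\alpha\beta,\alpha\beta'$ is in $I$; (iv) $I$ is generated by paths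 (of length at least two); (v) $A$ is finite-dimensional. It is locally string if it satisfies (i)-(iv) and is infinite-dimensional. $\mathcal B$ is the basis of $A$ of paths not in $I$; $A_n$ is the span of paths in $\mathcal B$ of length $n$; $A_{>n}=\bigoplus_{m>n}A_m$. $\langle\alpha\rangle$ is the two-sided ideal of $A$ generated by $\alpha$. A path $p\in\mathcal B$ is left (resp. right) maximal if $\alpha p=0$ (resp. $p\alpha=0$) in $A$ for all $\alpha\in Q_1$, and maximal if both. $\operatorname{Aut}_0(A)$ is the group of algebra automorphisms $f$ such that for every $n$ and $x\in A_n$ the degree $n$ component of $f(x)$ is $x$. For $\phi\in\operatorname{Aut}_0(A)$, elements $y_\alpha$ as in the claim always exist. For $a\in Q_1$ and $p\in\mathcal B$ such that (1) $p$ is parallel to $a$, (2) $p$ is left maximal or $F(p)=a$, (3) $p$ is right maximal or $L(p)=a$, $\delta_{(a,p)}$ is the derivation of $A$ sending $a$ to $p$ and every other arrow and every stationary path to $0$; $\delta_{(a,\sum\lambda_ip_i)}=\sum\lambda_i\delta_{(a,p_i)}$. A derivation is of type II if it equals $\sum_{a\in Q_1}\delta_{(a,y_a)}$ where each $y_a\in A_{>1}$ is a linear combination of left maximal paths satisfying (1)-(3) with respect to $a$. For a locally nilpotent derivation $\delta$, $\exp(\delta)(x)=\sum_{n}\frac1{n!}\delta^n(x)$, the sum being over those $n\ge 0$ with $\delta^n(x)\ne0$. *)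

theory Defs
  imports
    "HOL-Algebra.QuotRing"
    "HOL-Algebra.Module"
    "HOL-Algebra.Embedded_Algebras"
    "HOL-Computational_Algebra.Polynomial"
    "HOL-Library.Poly_Mapping"
    "Graph_Theory.Digraph_Component"
    "Graph_Theory.Arc_Walk"
begin

section \<open>Quivers and paths\<close>

definition quiver :: "('v, 'e) pre_digraph \<Rightarrow> bool" where
  "quiver Q \<longleftrightarrow> fin_digraph Q \<and> Digraph_Component.connected Q \<and> arcs Q \<noteq> {}"

text \<open>
  A path is its source vertex together with its list of arrows, read from left to right;
  the stationary path at \<open>v\<close> is \<open>(v, [])\<close>.
\<close>

type_synonym ('v, 'e) path = "'v \<times> 'e list"

definition path_source :: "('v, 'e) path \<Rightarrow> 'v" where
  "path_source p = fst p"

definition path_target :: "('v, 'e) pre_digraph \<Rightarrow> ('v, 'e) path \<Rightarrow> 'v" where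
  "path_target Q p = (if snd p = [] then fst p else head Q (last (snd p)))"

definition path_length :: "('v, 'e) path \<Rightarrow> nat" where
  "path_length p = length (snd p)"

definition paths :: "('v, 'e) pre_digraph \<Rightarrow> ('v, 'e) path set" where
  "paths Q = {p. pre_digraph.awalk Q (path_source p) (snd p) (path_target Q p)}"

definition stationary :: "'v \<Rightarrow> ('v, 'e) path" where
  "stationary v = (v, [])"

definition arrow :: "('v, 'e) pre_digraph \<Rightarrow> 'e \<Rightarrow> ('v, 'e) path" where
  "arrow Q a = (tail Q a, [a])"

text \<open>\<open>F(p)\<close> and \<open>L(p)\<close>, as paths of length at most one.\<close>

definition first_arrow :: "('v, 'e) pre_digraph \<Rightarrow> ('v, 'e) path \<Rightarrow> ('v, 'e) path" where
  "first_arrow Q p = (if snd p = [] then p else arrow Q (hd (snd p)))"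

definition last_arrow :: "('v, 'e) pre_digraph \<Rightarrow> ('v, 'e) path \<Rightarrow> ('v, 'e) path" where
  "last_arrow Q p = (if snd p = [] then p else arrow Q (last (snd p)))"

definition parallel :: "('v, 'e) pre_digraph \<Rightarrow> ('v, 'e) path \<Rightarrow> ('v, 'e) path \<Rightarrow> bool" where
  "parallel Q p q \<longleftrightarrow> path_source p = path_source q \<and> path_target Q p = path_target Q q"


section \<open>Algebras over a field\<close>

text \<open>
  The record type of \<open>HOL-Algebra.Module\<close> carries a (not necessarily commutative) algebra;
  the scalars are a type of class \<open>field\<close>.
\<close>

definition alg_iso ::
  "('k, 'a, 'm) module_scheme \<Rightarrow> ('k, 'b, 'n) module_scheme \<Rightarrow> ('a \<Rightarrow> 'b) set" where
  "alg_iso A B = {f \<in> ring_iso A B. \<forall>c. \<forall>x \<in> carrier A. f (c \<odot>\<^bsub>A\<^esub> x) = c \<odot>\<^bsub>B\<^esub> f x}"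

definition polynomial_algebra :: "('k::field, 'k poly) module" where
  "polynomial_algebra =
     \<lparr>carrier = UNIV, monoid.mult = (*), one = 1, zero = 0, add = (+), module.smult = Polynomial.smult\<rparr>"

definition finite_dimensional :: "('k::field, 'a, 'm) module_scheme \<Rightarrow> bool" where
  "finite_dimensional A \<longleftrightarrow>
     ring.finite_dimension A (range (\<lambda>c. c \<odot>\<^bsub>A\<^esub> \<one>\<^bsub>A\<^esub>)) (carrier A)"

definition derivation :: "('k::field, 'a, 'm) module_scheme \<Rightarrow> ('a \<Rightarrow> 'a) \<Rightarrow> bool" where
  "derivation A d \<longleftrightarrow> d \<in> carrier A \<rightarrow> carrier A \<and>
     (\<forall>x \<in> carrier A. \<forall>y \<in> carrier A. d (x \<oplus>\<^bsub>A\<^esub> y) = d x \<oplus>\<^bsub>A\<^esub> d y) \<and>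
     (\<forall>c. \<forall>x \<in> carrier A. d (c \<odot>\<^bsub>A\<^esub> x) = c \<odot>\<^bsub>A\<^esub> d x) \<and>
     (\<forall>x \<in> carrier A. \<forall>y \<in> carrier A.
        d (x \<otimes>\<^bsub>A\<^esub> y) = (d x \<otimes>\<^bsub>A\<^esub> y) \<oplus>\<^bsub>A\<^esub> (x \<otimes>\<^bsub>A\<^esub> d y))"

definition locally_nilpotent :: "('k::field, 'a, 'm) module_scheme \<Rightarrow> ('a \<Rightarrow> 'a) \<Rightarrow> bool" where
  "locally_nilpotent A d \<longleftrightarrow> (\<forall>x \<in> carrier A. \<exists>n. (d ^^ n) x = \<zero>\<^bsub>A\<^esub>)"

text \<open>
  Only the nonzero iterates enter the sum, so that in positive characteristic \<open>n!\<close> need not be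
  invertible for all \<open>n\<close>.  The value is meaningful only for locally nilpotent \<open>d\<close>, since
  \<open>finsum\<close> over an infinite set is \<open>\<zero>\<close>.
\<close>

definition deriv_exp :: "('k::field, 'a, 'm) module_scheme \<Rightarrow> ('a \<Rightarrow> 'a) \<Rightarrow> 'a \<Rightarrow> 'a" where
  "deriv_exp A d x =
     (\<Oplus>\<^bsub>A\<^esub> n \<in> {n. (d ^^ n) x \<noteq> \<zero>\<^bsub>A\<^esub>}. (1 / of_nat (fact n)) \<odot>\<^bsub>A\<^esub> (d ^^ n) x)"


section \<open>The path algebra and its quotients\<close>

definition path_mult ::
  "('v, 'e) pre_digraph \<Rightarrow> (('v, 'e) path \<Rightarrow>\<^sub>0 'k::field) \<Rightarrow> (('v, 'e) path \<Rightarrow>\<^sub>0 'k) \<Rightarrow>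
     (('v, 'e) path \<Rightarrow>\<^sub>0 'k)" where
  "path_mult Q f g =
     (\<Sum>p \<in> Poly_Mapping.keys f. \<Sum>q \<in> Poly_Mapping.keys g.
        if path_target Q p = path_source q
        then Poly_Mapping.single (path_source p, snd p @ snd q)
               (Poly_Mapping.lookup f p * Poly_Mapping.lookup g q)
        else 0)"

definition path_algebra ::
  "('v, 'e) pre_digraph \<Rightarrow> ('k::field, ('v, 'e) path \<Rightarrow>\<^sub>0 'k) module" where
  "path_algebra Q =
     \<lparr>carrier = {f. Poly_Mapping.keys f \<subseteq> paths Q},
      monoid.mult = path_mult Q,
      one = (\<Sum>v \<in> verts Q. Poly_Mapping.single (stationary v) 1),
      zero = 0,
      add = (+),
      module.smult = (\<lambda>c. Poly_Mapping.map ((*) c))\<rparr>"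

definition path_elem :: "('v, 'e) path \<Rightarrow> (('v, 'e) path \<Rightarrow>\<^sub>0 'k::field)" where
  "path_elem p = Poly_Mapping.single p 1"

text \<open>
  The ring structure of \<open>\<Bbbk>Q/I\<close> is that of \<open>FactRing\<close>; its elements are the cosets of \<open>I\<close>.
\<close>

definition quot_algebra ::
  "('v, 'e) pre_digraph \<Rightarrow> (('v, 'e) path \<Rightarrow>\<^sub>0 'k::field) set \<Rightarrow>
     ('k, (('v, 'e) path \<Rightarrow>\<^sub>0 'k) set) module" where
  "quot_algebra Q I =
     ring.extend (path_algebra Q Quot I)
       (module.fields
         (\<lambda>c X. \<Union>x \<in> X. I +>\<^bsub>path_algebra Q\<^esub> (c \<odot>\<^bsub>path_algebra Q\<^esub> x)))"

definition coset ::
  "('v, 'e) pre_digraph \<Rightarrow> (('v, 'e) path \<Rightarrow>\<^sub>0 'k::field) set \<Rightarrow>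
     (('v, 'e) path \<Rightarrow>\<^sub>0 'k) \<Rightarrow> (('v, 'e) path \<Rightarrow>\<^sub>0 'k) set" where
  "coset Q I f = I +>\<^bsub>path_algebra Q\<^esub> f"

abbreviation path_class ::
  "('v, 'e) pre_digraph \<Rightarrow> (('v, 'e) path \<Rightarrow>\<^sub>0 'k::field) set \<Rightarrow>
     ('v, 'e) path \<Rightarrow> (('v, 'e) path \<Rightarrow>\<^sub>0 'k) set" where
  "path_class Q I p \<equiv> coset Q I (path_elem p)"


section \<open>String and locally string algebras\<close>

text \<open>
  The conditions shared by string and locally string algebras, which differ only in the
  dimension of the quotient.  The set \<open>R\<close> of generating paths may be infinite.
\<close>

definition string_relations ::
  "('v, 'e) pre_digraph \<Rightarrow> (('v, 'e) path \<Rightarrow>\<^sub>0 'k::field) set \<Rightarrow> bool" where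
  "string_relations Q I \<longleftrightarrow>
     (\<forall>v \<in> verts Q. in_degree Q v \<le> 2 \<and> out_degree Q v \<le> 2) \<and>
     (\<forall>a \<in> arcs Q. \<forall>b \<in> arcs Q. \<forall>b' \<in> arcs Q.
        tail Q a = head Q b \<and> tail Q a = head Q b' \<and> b \<noteq> b' \<longrightarrow>
        path_elem (arrow Q b) \<otimes>\<^bsub>path_algebra Q\<^esub> path_elem (arrow Q a) \<in> I \<or>
        path_elem (arrow Q b') \<otimes>\<^bsub>path_algebra Q\<^esub> path_elem (arrow Q a) \<in> I) \<and>
     (\<forall>a \<in> arcs Q. \<forall>b \<in> arcs Q. \<forall>b' \<in> arcs Q.
        head Q a = tail Q b \<and> head Q a = tail Q b' \<and> b \<noteq> b' \<longrightarrow>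
        path_elem (arrow Q a) \<otimes>\<^bsub>path_algebra Q\<^esub> path_elem (arrow Q b) \<in> I \<or>
        path_elem (arrow Q a) \<otimes>\<^bsub>path_algebra Q\<^esub> path_elem (arrow Q b') \<in> I) \<and>
     (\<exists>R \<subseteq> {p \<in> paths Q. path_length p \<ge> 2}. I = Idl\<^bsub>path_algebra Q\<^esub> (path_elem ` R))"

definition string_algebra ::
  "('v, 'e) pre_digraph \<Rightarrow> (('v, 'e) path \<Rightarrow>\<^sub>0 'k::field) set \<Rightarrow> bool" where
  "string_algebra Q I \<longleftrightarrow>
     quiver Q \<and> string_relations Q I \<and> finite_dimensional (quot_algebra Q I)"

definition locally_string_algebra ::
  "('v, 'e) pre_digraph \<Rightarrow> (('v, 'e) path \<Rightarrow>\<^sub>0 'k::field) set \<Rightarrow> bool" where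
  "locally_string_algebra Q I \<longleftrightarrow>
     quiver Q \<and> string_relations Q I \<and> \<not> finite_dimensional (quot_algebra Q I)"


section \<open>The basis of nonzero paths and the grading\<close>

definition basis_paths ::
  "('v, 'e) pre_digraph \<Rightarrow> (('v, 'e) path \<Rightarrow>\<^sub>0 'k::field) set \<Rightarrow> ('v, 'e) path set" where
  "basis_paths Q I = {p \<in> paths Q. path_elem p \<notin> I}"

text \<open>The linear combinations, in \<open>\<Bbbk>Q/I\<close>, of the paths in \<open>P\<close>.\<close>

definition path_span ::
  "('v, 'e) pre_digraph \<Rightarrow> (('v, 'e) path \<Rightarrow>\<^sub>0 'k::field) set \<Rightarrow> ('v, 'e) path set \<Rightarrow>
     (('v, 'e) path \<Rightarrow>\<^sub>0 'k) set set" where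
  "path_span Q I P = coset Q I ` {f. Poly_Mapping.keys f \<subseteq> P}"

definition graded_part ::
  "('v, 'e) pre_digraph \<Rightarrow> (('v, 'e) path \<Rightarrow>\<^sub>0 'k::field) set \<Rightarrow> nat \<Rightarrow>
     (('v, 'e) path \<Rightarrow>\<^sub>0 'k) set set" where
  "graded_part Q I n = path_span Q I {p \<in> basis_paths Q I. path_length p = n}"

definition graded_part_gt ::
  "('v, 'e) pre_digraph \<Rightarrow> (('v, 'e) path \<Rightarrow>\<^sub>0 'k::field) set \<Rightarrow> nat \<Rightarrow>
     (('v, 'e) path \<Rightarrow>\<^sub>0 'k) set set" where
  "graded_part_gt Q I n = path_span Q I {p \<in> basis_paths Q I. path_length p > n}"

text \<open>
  The coordinates of \<open>x\<close> with respect to the basis of nonzero paths: since \<open>I\<close> is generated by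
  paths, the coset \<open>x\<close> contains exactly one combination of paths outside \<open>I\<close>.
\<close>

definition coords ::
  "('v, 'e) pre_digraph \<Rightarrow> (('v, 'e) path \<Rightarrow>\<^sub>0 'k::field) set \<Rightarrow>
     (('v, 'e) path \<Rightarrow>\<^sub>0 'k) set \<Rightarrow> (('v, 'e) path \<Rightarrow>\<^sub>0 'k)" where
  "coords Q I x = (THE f. f \<in> x \<and> Poly_Mapping.keys f \<subseteq> basis_paths Q I)"

definition degree_component ::
  "('v, 'e) pre_digraph \<Rightarrow> (('v, 'e) path \<Rightarrow>\<^sub>0 'k::field) set \<Rightarrow> nat \<Rightarrow>
     (('v, 'e) path \<Rightarrow>\<^sub>0 'k) set \<Rightarrow> (('v, 'e) path \<Rightarrow>\<^sub>0 'k) set" where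
  "degree_component Q I n x =
     coset Q I (\<Sum>p \<in> {p \<in> Poly_Mapping.keys (coords Q I x). path_length p = n}.
       Poly_Mapping.single p (Poly_Mapping.lookup (coords Q I x) p))"

definition Aut0 ::
  "('v, 'e) pre_digraph \<Rightarrow> (('v, 'e) path \<Rightarrow>\<^sub>0 'k::field) set \<Rightarrow>
     ((('v, 'e) path \<Rightarrow>\<^sub>0 'k) set \<Rightarrow> (('v, 'e) path \<Rightarrow>\<^sub>0 'k) set) set" where
  "Aut0 Q I = {f \<in> alg_iso (quot_algebra Q I) (quot_algebra Q I).
     \<forall>n. \<forall>x \<in> graded_part Q I n. degree_component Q I n (f x) = x}"


section \<open>Maximal paths and derivations of type II\<close>

definition left_maximal ::
  "('v, 'e) pre_digraph \<Rightarrow> (('v, 'e) path \<Rightarrow>\<^sub>0 'k::field) set \<Rightarrow> ('v, 'e) path \<Rightarrow> bool" where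
  "left_maximal Q I p \<longleftrightarrow> p \<in> basis_paths Q I \<and>
     (\<forall>a \<in> arcs Q. path_class Q I (arrow Q a) \<otimes>\<^bsub>quot_algebra Q I\<^esub> path_class Q I p
        = \<zero>\<^bsub>quot_algebra Q I\<^esub>)"

definition right_maximal ::
  "('v, 'e) pre_digraph \<Rightarrow> (('v, 'e) path \<Rightarrow>\<^sub>0 'k::field) set \<Rightarrow> ('v, 'e) path \<Rightarrow> bool" where
  "right_maximal Q I p \<longleftrightarrow> p \<in> basis_paths Q I \<and>
     (\<forall>a \<in> arcs Q. path_class Q I p \<otimes>\<^bsub>quot_algebra Q I\<^esub> path_class Q I (arrow Q a)
        = \<zero>\<^bsub>quot_algebra Q I\<^esub>)"

definition maximal_path ::
  "('v, 'e) pre_digraph \<Rightarrow> (('v, 'e) path \<Rightarrow>\<^sub>0 'k::field) set \<Rightarrow> ('v, 'e) path \<Rightarrow> bool" where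
  "maximal_path Q I p \<longleftrightarrow> left_maximal Q I p \<and> right_maximal Q I p"

text \<open>The conditions on \<open>p\<close> under which sending \<open>a\<close> to \<open>p\<close> defines a derivation.\<close>

definition derivation_pair ::
  "('v, 'e) pre_digraph \<Rightarrow> (('v, 'e) path \<Rightarrow>\<^sub>0 'k::field) set \<Rightarrow> 'e \<Rightarrow> ('v, 'e) path \<Rightarrow> bool"
  where
  "derivation_pair Q I a p \<longleftrightarrow> p \<in> basis_paths Q I \<and>
     parallel Q p (arrow Q a) \<and>
     (left_maximal Q I p \<or> first_arrow Q p = arrow Q a) \<and>
     (right_maximal Q I p \<or> last_arrow Q p = arrow Q a)"

text \<open>
  \<open>\<delta>\<^bsub>(a,p)\<^esub>\<close>, for \<open>(a, p)\<close> a derivation pair: the derivation sending \<open>a\<close> to \<open>p\<close> and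
  all other arrows and all stationary paths to zero.  The restriction to \<open>extensional\<close> functions only
  fixes the irrelevant values outside the carrier, so that the description is unique.
\<close>

definition path_derivation ::
  "('v, 'e) pre_digraph \<Rightarrow> (('v, 'e) path \<Rightarrow>\<^sub>0 'k::field) set \<Rightarrow> 'e \<Rightarrow> ('v, 'e) path \<Rightarrow>
     (('v, 'e) path \<Rightarrow>\<^sub>0 'k) set \<Rightarrow> (('v, 'e) path \<Rightarrow>\<^sub>0 'k) set" where
  "path_derivation Q I a p = (THE d.
     derivation (quot_algebra Q I) d \<and> d \<in> extensional (carrier (quot_algebra Q I)) \<and>
     d (path_class Q I (arrow Q a)) = path_class Q I p \<and>
     (\<forall>b \<in> arcs Q - {a}. d (path_class Q I (arrow Q b)) = \<zero>\<^bsub>quot_algebra Q I\<^esub>) \<and>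
     (\<forall>v \<in> verts Q. d (path_class Q I (stationary v)) = \<zero>\<^bsub>quot_algebra Q I\<^esub>))"

text \<open>\<open>\<delta>\<^bsub>(a,y)\<^esub>\<close> for a linear combination \<open>y\<close> of paths.\<close>

definition elem_derivation ::
  "('v, 'e) pre_digraph \<Rightarrow> (('v, 'e) path \<Rightarrow>\<^sub>0 'k::field) set \<Rightarrow> 'e \<Rightarrow>
     (('v, 'e) path \<Rightarrow>\<^sub>0 'k) set \<Rightarrow>
     (('v, 'e) path \<Rightarrow>\<^sub>0 'k) set \<Rightarrow> (('v, 'e) path \<Rightarrow>\<^sub>0 'k) set" where
  "elem_derivation Q I a y x =
     (\<Oplus>\<^bsub>quot_algebra Q I\<^esub> p \<in> Poly_Mapping.keys (coords Q I y).
        Poly_Mapping.lookup (coords Q I y) p \<odot>\<^bsub>quot_algebra Q I\<^esub> path_derivation Q I a p x)"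

definition type_II ::
  "('v, 'e) pre_digraph \<Rightarrow> (('v, 'e) path \<Rightarrow>\<^sub>0 'k::field) set \<Rightarrow>
     ((('v, 'e) path \<Rightarrow>\<^sub>0 'k) set \<Rightarrow> (('v, 'e) path \<Rightarrow>\<^sub>0 'k) set) \<Rightarrow> bool" where
  "type_II Q I d \<longleftrightarrow> derivation (quot_algebra Q I) d \<and>
     (\<exists>y. (\<forall>a \<in> arcs Q. y a \<in> graded_part_gt Q I 1 \<and>
              y a \<in> path_span Q I {p. left_maximal Q I p \<and> derivation_pair Q I a p}) \<and>
          (\<forall>x \<in> carrier (quot_algebra Q I).
             d x = (\<Oplus>\<^bsub>quot_algebra Q I\<^esub> a \<in> arcs Q. elem_derivation Q I a (y a) x)))"

end

theory Submission
  imports Defs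
begin

text \<open>
  Since \<open>I\<close> is generated by paths of length at least two, the paths outside \<open>I\<close> are coordinates on
  \<open>A\<close>, and all arrows and stationary paths are among them.  Write \<open>x\<^sub>q\<close> for the coordinate of \<open>x\<close>
  at the path \<open>q\<close>.  The proof rests on two formulas.  First, an arrow factors only trivially, so
  \<open>(x y)\<^sub>\<alpha> = x\<^sub>s y\<^sub>\<alpha> + x\<^sub>\<alpha> y\<^sub>t\<close> where \<open>s\<close> and \<open>t\<close> are the stationary paths at the ends of \<open>\<alpha>\<close>
  (\<open>lookup_path_mult_arrow\<close>).  Second, a maximal path \<open>p\<close> is killed by every path of positive length,
  so \<open>x p\<close> and \<open>p x\<close> are the multiples of \<open>p\<close> by the coordinates of \<open>x\<close> at the stationary paths at
  the source and at the target of \<open>p\<close> (\<open>mult_left_maximal\<close>, \<open>mult_right_maximal\<close>).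

  Together they show that \<open>x \<mapsto> (\<Sum>\<alpha>. x\<^sub>\<alpha> y\<^sub>\<alpha>)\<close> is a derivation whenever each \<open>y\<^sub>\<alpha>\<close> is a combination of
  maximal paths parallel to \<open>\<alpha>\<close> (\<open>quot_arrow_subst_derivation\<close>).  A derivation is determined by its
  values on arrows and stationary paths, so this one is \<open>\<Sum>\<alpha>. \<delta>\<^bsub>(\<alpha>, y\<^sub>\<alpha>)\<^esub>\<close>
  (\<open>sum_elem_derivation_maximal\<close>); replacing \<open>y\<^sub>\<alpha>\<close> by \<open>- y\<^sub>\<alpha>\<close> gives \<open>\<delta>\<close>, which is therefore of
  type II.

  The \<open>y\<^sub>\<alpha>\<close> have no coordinates at arrows, their paths being longer.  Hence \<open>\<delta> \<circ> \<delta> = 0\<close> and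
  \<open>exp(\<delta>)(x) = x + \<delta>(x)\<close>; the only denominators that occur are \<open>0! = 1! = 1\<close>.  Finally, write
  \<open>\<phi>(\<alpha>) = i + y\<^sub>\<alpha>\<close> with \<open>i\<close> in the ideal generated by \<open>\<alpha>\<close>.  Because \<open>\<phi>(\<alpha>)\<close> has degree one
  component \<open>\<alpha>\<close>, the only arrow at which \<open>\<phi>(\<alpha>)\<close> has a nonzero coordinate is \<open>\<alpha>\<close>, with coordinate \<open>1\<close>
  (\<open>degree_one_coefficients\<close>).  So \<open>\<delta>(\<phi>(\<alpha>)) = - y\<^sub>\<alpha>\<close>, and \<open>exp(\<delta>)(\<phi>(\<alpha>)) = i\<close>.
\<close>


section \<open>Linear combinations of paths\<close>

abbreviation keys where "keys \<equiv> Poly_Mapping.keys"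
abbreviation lookup where "lookup \<equiv> Poly_Mapping.lookup"
abbreviation single where "single \<equiv> Poly_Mapping.single"

lemma poly_mapping_eq_sum_single:
  "(f :: 'a \<Rightarrow>\<^sub>0 'b::comm_monoid_add) = (\<Sum>p\<in>keys f. single p (lookup f p))"
  by (rule poly_mapping_eqI)
     (auto simp: lookup_sum lookup_single when_def in_keys_iff sum.delta' cong: if_cong)

text \<open>
  Linearity as an induction principle: an additive statement about the combinations of elements
  of \<open>S\<close> has to be checked only on the multiples of single elements of \<open>S\<close>.
\<close>

lemma keys_subset_induct [consumes 1, case_names zero single add]:
  fixes f :: "'a \<Rightarrow>\<^sub>0 'b::comm_monoid_add"
  assumes "keys f \<subseteq> S"
    and "P 0"
    and "\<And>p c. p \<in> S \<Longrightarrow> P (single p c)"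
    and "\<And>f g. keys f \<subseteq> S \<Longrightarrow> keys g \<subseteq> S \<Longrightarrow> P f \<Longrightarrow> P g \<Longrightarrow> P (f + g)"
  shows "P f"
proof -
  have "keys (sum h K) \<subseteq> S \<and> P (sum h K)"
    if "finite K" "\<And>p. p \<in> K \<Longrightarrow> p \<in> S \<and> h p = single p (lookup f p)" for h K
    using that
  proof (induction K)
    case empty
    then show ?case using assms(2) by simp
  next
    case (insert x F)
    have "keys (h x) \<subseteq> S" "P (h x)" using insert.prems assms(3) by (auto split: if_splits)
    moreover have "keys (sum h F) \<subseteq> S \<and> P (sum h F)" using insert by auto
    ultimately show ?case
      using insert.hyps assms(4)[of "h x" "sum h F"] keys_add[of "h x" "sum h F"] by auto
  qed
  from this[of "keys f" "\<lambda>p. single p (lookup f p)"] assms(1)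
  show ?thesis using poly_mapping_eq_sum_single[of f] by auto
qed

text \<open>
  The scalar action of the path algebra under a name of its own, which keeps the scalar \<open>c\<close> visible
  to rewriting; inside the function \<open>(*) c\<close> it would be subject to rewriting as a function.
\<close>

definition scale :: "'k::field \<Rightarrow> ('a \<Rightarrow>\<^sub>0 'k) \<Rightarrow> 'a \<Rightarrow>\<^sub>0 'k"  (infixr \<open>*s\<close> 75) where
  "c *s f = Poly_Mapping.map ((*) c) f"

lemma lookup_scale: "lookup (c *s f) p = c * lookup f p"
  by (auto simp: scale_def Poly_Mapping.map.rep_eq when_def)

lemma keys_scale: "keys f \<subseteq> S \<Longrightarrow> keys (c *s f) \<subseteq> S"
  by (auto simp: in_keys_iff lookup_scale)

lemma scale_zero [simp]: "c *s 0 = 0"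
  and scale_zero_left [simp]: "0 *s f = 0"
  and scale_one [simp]: "1 *s f = f"
  and scale_add: "c *s (f + g) = c *s f + c *s g"
  and scale_add_left: "(c + d) *s f = c *s f + d *s f"
  and scale_diff: "c *s (f - g) = c *s f - c *s g"
  and scale_scale: "c *s d *s f = (c * d) *s f"
  by (simp_all add: poly_mapping_eq_iff fun_eq_iff lookup_scale lookup_add lookup_minus algebra_simps)

lemma scale_single: "c *s single p d = single p (c * d)"
  by (rule poly_mapping_eqI) (simp add: lookup_scale lookup_single when_def)

lemma scale_sum: "c *s sum h K = (\<Sum>k\<in>K. c *s h k)"
  by (induction K rule: infinite_finite_induct) (auto simp: scale_add)

section \<open>The path algebra is a ring\<close>

lemma path_mult_single:
  "path_mult Q (single p c) (single q d) =
     (if path_target Q p = path_source q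
      then single (path_source p, snd p @ snd q) (c * d) else 0)"
  by (auto simp: path_mult_def)

text \<open>
  The index sets in the definition of the product depend on the factors.  Allowing larger finite
  index sets makes it possible to compare several products term by term, which yields
  bilinearity.
\<close>

lemma path_mult_eq_sum:
  assumes "finite S" "finite T" "keys f \<subseteq> S" "keys g \<subseteq> T"
  shows "path_mult Q f g = (\<Sum>p\<in>S. \<Sum>q\<in>T.
    path_mult Q (single p (lookup f p)) (single q (lookup g q)))"
proof -
  have "path_mult Q f g = (\<Sum>p\<in>keys f. \<Sum>q\<in>T.
    path_mult Q (single p (lookup f p)) (single q (lookup g q)))"
    unfolding path_mult_def[of Q f g] path_mult_single
    by (intro sum.cong sum.mono_neutral_left refl assms) (auto simp: in_keys_iff)
  also have "\<dots> = (\<Sum>p\<in>S. \<Sum>q\<in>T.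
    path_mult Q (single p (lookup f p)) (single q (lookup g q)))"
    by (intro sum.mono_neutral_left assms) (auto simp: in_keys_iff path_mult_def)
  finally show ?thesis .
qed

lemma path_mult_add_left: "path_mult Q (f + f') g = path_mult Q f g + path_mult Q f' g"
proof -
  let ?S = "keys f \<union> keys f'" and ?T = "keys g"
  note E = path_mult_eq_sum[of ?S ?T]
  have "path_mult Q (f + f') g = (\<Sum>p\<in>?S. \<Sum>q\<in>?T.
    path_mult Q (single p (lookup f p)) (single q (lookup g q))
    + path_mult Q (single p (lookup f' p)) (single q (lookup g q)))"
    by (subst E)
       (auto simp: lookup_add path_mult_single single_add[symmetric] distrib_right[symmetric]
         dest: keys_add[THEN subsetD] intro!: sum.cong)
  also have "\<dots> = path_mult Q f g + path_mult Q f' g"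
    by (simp add: sum.distrib E[of f g] E[of f' g])
  finally show ?thesis .
qed

lemma path_mult_add_right: "path_mult Q f (g + g') = path_mult Q f g + path_mult Q f g'"
proof -
  let ?S = "keys f" and ?T = "keys g \<union> keys g'"
  note E = path_mult_eq_sum[of ?S ?T]
  have "path_mult Q f (g + g') = (\<Sum>p\<in>?S. \<Sum>q\<in>?T.
    path_mult Q (single p (lookup f p)) (single q (lookup g q))
    + path_mult Q (single p (lookup f p)) (single q (lookup g' q)))"
    by (subst E)
       (auto simp: lookup_add path_mult_single single_add[symmetric] distrib_left[symmetric]
         dest: keys_add[THEN subsetD] intro!: sum.cong)
  also have "\<dots> = path_mult Q f g + path_mult Q f g'"
    by (simp add: sum.distrib E[of f g] E[of f g'])
  finally show ?thesis .
qed

lemma path_mult_zero [simp]: "path_mult Q 0 g = 0" "path_mult Q f 0 = 0"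
  by (auto simp: path_mult_def)

lemma path_mult_assoc: "path_mult Q (path_mult Q f g) h = path_mult Q f (path_mult Q g h)"
proof (induction f rule: keys_subset_induct[where S = UNIV, OF subset_UNIV])
  case (2 p c)
  show ?case
  proof (induction g rule: keys_subset_induct[where S = UNIV, OF subset_UNIV])
    case (2 q d)
    show ?case
    proof (induction h rule: keys_subset_induct[where S = UNIV, OF subset_UNIV])
      case (2 r e)
      show ?case
        by (auto simp: path_mult_single path_target_def path_source_def mult.assoc)
    qed (auto simp: path_mult_add_right path_mult_add_left)
  qed (auto simp: path_mult_add_right path_mult_add_left)
qed (auto simp: path_mult_add_right path_mult_add_left)

lemma path_mult_scale_left: "path_mult Q (c *s f) g = c *s (path_mult Q f g)"
proof (induction f rule: keys_subset_induct[where S = UNIV, OF subset_UNIV])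
  case (2 p d)
  show ?case
    by (induction g rule: keys_subset_induct[where S = UNIV, OF subset_UNIV])
       (auto simp: path_mult_single scale_single path_mult_add_right scale_add mult.assoc)
qed (auto simp: path_mult_add_left scale_add)

lemma path_mult_scale_right: "path_mult Q f (c *s g) = c *s (path_mult Q f g)"
proof (induction f rule: keys_subset_induct[where S = UNIV, OF subset_UNIV])
  case (2 p d)
  show ?case
    by (induction g rule: keys_subset_induct[where S = UNIV, OF subset_UNIV])
       (auto simp: path_mult_single scale_single path_mult_add_right scale_add mult.left_commute)
qed (auto simp: path_mult_add_left scale_add)

lemma keys_path_mult:
  "keys (path_mult Q f g) \<subseteq>
     {(path_source p, snd p @ snd q) | p q. p \<in> keys f \<and> q \<in> keys g \<and>
        path_target Q p = path_source q}" (is "_ \<subseteq> ?K")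
proof -
  have "lookup (path_mult Q f g) r = 0" if "r \<notin> ?K" for r
    using that unfolding path_mult_def
    by (auto simp: lookup_sum lookup_single when_def intro!: sum.neutral)
  then show ?thesis unfolding in_keys_iff subset_iff by blast
qed

lemma paths_append:
  assumes "p \<in> paths Q" "q \<in> paths Q" "path_target Q p = path_source q"
  shows "(path_source p, snd p @ snd q) \<in> paths Q"
proof -
  have cas: "pre_digraph.cas Q u (xs @ ys) w"
    if "pre_digraph.cas Q u xs v" "pre_digraph.cas Q v ys w" for u v w xs ys
    using that by (induction xs arbitrary: u) (auto simp: pre_digraph.cas.simps)
  show ?thesis
    using assms cas[of "path_source p" "snd p" "path_target Q p" "snd q" "path_target Q q"]
    by (auto simp: paths_def pre_digraph.awalk_def path_source_def path_target_def pre_digraph.cas.simps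
      split: if_splits)
qed

lemma stationary_in_paths: "stationary v \<in> paths Q \<longleftrightarrow> v \<in> verts Q"
  by (auto simp: paths_def pre_digraph.awalk_def path_source_def path_target_def stationary_def pre_digraph.cas.simps)

lemma arrow_in_paths: "fin_digraph Q \<Longrightarrow> a \<in> arcs Q \<Longrightarrow> arrow Q a \<in> paths Q"
  using wf_digraph.tail_in_verts[of Q a] 
  by (auto simp: paths_def pre_digraph.awalk_def path_source_def path_target_def arrow_def pre_digraph.cas.simps
     fin_digraph_def)

text \<open>
  The only factorizations of an arrow into two paths are those with a stationary path at its source
  on the left or at its target on the right.
\<close>

lemma lookup_path_mult_arrow:
  "lookup (path_mult Q f g) (arrow Q a) =
     lookup f (stationary (tail Q a)) * lookup g (arrow Q a) +
     lookup f (arrow Q a) * lookup g (stationary (head Q a))"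
proof (induction f rule: keys_subset_induct[where S = UNIV, OF subset_UNIV])
  case (2 p c)
  show ?case
  proof (induction g rule: keys_subset_induct[where S = UNIV, OF subset_UNIV])
    case (2 q d)
    obtain u es v fs where pq: "p = (u, es)" "q = (v, fs)" by fastforce
    have "es @ fs = [a] \<longleftrightarrow> es = [] \<and> fs = [a] \<or> es = [a] \<and> fs = []"
      by (auto simp: append_eq_Cons_conv)
    then show ?case
      by (auto simp: pq path_mult_single lookup_single when_def arrow_def stationary_def path_source_def path_target_def)
  qed (auto simp: path_mult_add_right lookup_add algebra_simps)
qed (auto simp: path_mult_add_left lookup_add algebra_simps)

lemma path_algebra_simps:
  "carrier (path_algebra Q) = {f. keys f \<subseteq> paths Q}"
  "f \<otimes>\<^bsub>path_algebra Q\<^esub> g = path_mult Q f g"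
  "\<one>\<^bsub>path_algebra Q\<^esub> = (\<Sum>v \<in> verts Q. single (stationary v) 1)"
  "\<zero>\<^bsub>path_algebra Q\<^esub> = 0"
  "f \<oplus>\<^bsub>path_algebra Q\<^esub> g = f + g"
  "c \<odot>\<^bsub>path_algebra Q\<^esub> f = c *s f"
  by (simp_all add: path_algebra_def scale_def)

lemma path_mult_sum_left: "path_mult Q (sum h K) g = (\<Sum>k\<in>K. path_mult Q (h k) g)"
  by (induction K rule: infinite_finite_induct) (auto simp: path_mult_add_left)

lemma path_mult_sum_right: "path_mult Q g (sum h K) = (\<Sum>k\<in>K. path_mult Q g (h k))"
  by (induction K rule: infinite_finite_induct) (auto simp: path_mult_add_right)

lemma path_source_in_verts: "p \<in> paths Q \<Longrightarrow> path_source p \<in> verts Q"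
  by (auto simp: paths_def pre_digraph.awalk_def)

lemma path_target_in_verts:
  assumes "fin_digraph Q" "p \<in> paths Q" shows "path_target Q p \<in> verts Q"
proof -
  interpret fin_digraph Q by fact
  show ?thesis using assms(2) by (auto simp: paths_def)
qed

lemma path_algebra_ring:
  assumes "fin_digraph Q"
  shows "ring (path_algebra Q :: ('k::field, ('v, 'e) path \<Rightarrow>\<^sub>0 'k) module)"
    (is "ring ?P")
proof (rule ringI)
  interpret fin_digraph Q by fact
  show "abelian_group ?P"
  proof (rule abelian_groupI)
    fix x assume "x \<in> carrier ?P"
    then show "\<exists>y\<in>carrier ?P. y \<oplus>\<^bsub>?P\<^esub> x = \<zero>\<^bsub>?P\<^esub>"
      by (intro bexI[of _ "- x"]) (auto simp: path_algebra_simps)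
  qed (simp_all add: path_algebra_simps ac_simps order_trans[OF keys_add])
  have closed: "keys (path_mult Q f g) \<subseteq> paths Q"
    if "keys f \<subseteq> paths Q" "keys g \<subseteq> paths Q" for f g :: "('v, 'e) path \<Rightarrow>\<^sub>0 'k"
  proof
    fix r assume "r \<in> keys (path_mult Q f g)"
    then obtain p q where "r = (path_source p, snd p @ snd q)" "p \<in> keys f" "q \<in> keys g"
      "path_target Q p = path_source q" using keys_path_mult[of Q f g] by blast
    then show "r \<in> paths Q" using that paths_append by blast
  qed
  have one: "keys (\<Sum>v \<in> verts Q. single (stationary v :: ('v, 'e) path) (1::'k)) \<subseteq> paths Q"
  proof
    fix p :: "('v, 'e) path" assume "p \<in> keys (\<Sum>v \<in> verts Q. single (stationary v) (1::'k))"
    then have "(\<Sum>v \<in> verts Q. lookup (single (stationary v) (1::'k)) p) \<noteq> 0"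
      by (simp add: in_keys_iff lookup_sum)
    then obtain v where "v \<in> verts Q" "lookup (single (stationary v) (1::'k)) p \<noteq> 0"
      by (rule sum.not_neutral_contains_not_neutral)
    then show "p \<in> paths Q"
      by (cases "stationary v = p") (auto simp: lookup_single_not_eq stationary_in_paths)
  qed
  have left: "path_mult Q (\<Sum>v \<in> verts Q. single (stationary v) 1) f = f"
    if "keys f \<subseteq> paths Q" for f :: "('v, 'e) path \<Rightarrow>\<^sub>0 'k"
    using that
  proof (induction f rule: keys_subset_induct)
    case (single p c)
    have "path_mult Q (\<Sum>v \<in> verts Q. single (stationary v) 1) (single p c) =
      (\<Sum>v\<in>verts Q. if v = path_source p then single p c else 0)"
      unfolding path_mult_sum_left
      by (intro sum.cong) (auto simp: path_mult_single stationary_def path_target_def path_source_def)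
    then show ?case using path_source_in_verts[OF single] by simp
  qed (auto simp: path_mult_add_right)
  have right: "path_mult Q f (\<Sum>v \<in> verts Q. single (stationary v) 1) = f"
    if "keys f \<subseteq> paths Q" for f :: "('v, 'e) path \<Rightarrow>\<^sub>0 'k"
    using that
  proof (induction f rule: keys_subset_induct)
    case (single p c)
    have "path_mult Q (single p c) (\<Sum>v \<in> verts Q. single (stationary v) 1) =
      (\<Sum>v\<in>verts Q. if v = path_target Q p then single p c else 0)"
      unfolding path_mult_sum_right
      by (intro sum.cong) (auto simp: path_mult_single stationary_def path_source_def)
    then show ?case using path_target_in_verts[OF assms single] by simp
  qed (auto simp: path_mult_add_left)
  show "Group.monoid ?P"
    by (rule monoidI) (simp_all add: path_algebra_simps path_mult_assoc left right closed one)
qed (simp_all add: path_algebra_simps path_mult_add_left path_mult_add_right)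

section \<open>Quotients by ideals generated by paths\<close>

lemma ring_extend:
  fixes R :: "'a ring"
  assumes "ring R"
  shows "ring (ring.extend R m)"
proof -
  interpret ring R by fact
  show ?thesis
  proof (intro ringI abelian_groupI monoidI)
    fix x assume "x \<in> carrier (ring.extend R m)"
    then show "\<exists>y\<in>carrier (ring.extend R m). y \<oplus>\<^bsub>ring.extend R m\<^esub> x = \<zero>\<^bsub>ring.extend R m\<^esub>"
      using a_inv_closed[of x] l_neg[of x] by (auto simp: ring.defs)
  qed (simp_all add: ring.defs m_assoc a_ac l_distr r_distr)
qed


text \<open>
  A set of paths that is stable under concatenation with arbitrary paths on either side spans an
  ideal.  Such spans bound ideals generated by paths from above, without a description of the
  elements of the generated ideal.
\<close>

lemma ideal_of_keys:
  fixes Q :: "('v, 'e) pre_digraph"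
  assumes Q: "fin_digraph Q" and N: "N \<subseteq> paths Q"
    and left: "\<And>p q. p \<in> paths Q \<Longrightarrow> q \<in> N \<Longrightarrow> path_target Q p = path_source q \<Longrightarrow>
       (path_source p, snd p @ snd q) \<in> N"
    and right: "\<And>p q. p \<in> N \<Longrightarrow> q \<in> paths Q \<Longrightarrow> path_target Q p = path_source q \<Longrightarrow>
       (path_source p, snd p @ snd q) \<in> N"
  shows "ideal {f. keys f \<subseteq> N} (path_algebra Q :: ('k::field, ('v, 'e) path \<Rightarrow>\<^sub>0 'k) module)"
    (is "ideal ?J ?P")
proof (rule idealI[OF path_algebra_ring[OF Q]])
  interpret ring ?P by (rule path_algebra_ring[OF Q])
  have inv: "\<ominus>\<^bsub>?P\<^esub> f = - f" if "f \<in> carrier ?P" for f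
    by (rule minus_equality) (use that in \<open>auto simp: path_algebra_simps\<close>)
  show "subgroup ?J (add_monoid ?P)"
  proof (rule add.subgroupI)
    show "?J \<subseteq> carrier ?P" using N by (auto simp: path_algebra_simps)
    show "?J \<noteq> {}" by (auto intro: exI[of _ 0])
    show "\<ominus>\<^bsub>?P\<^esub> f \<in> ?J" if "f \<in> ?J" for f
      using that N by (subst inv) (auto simp: path_algebra_simps)
    show "f \<oplus>\<^bsub>?P\<^esub> g \<in> ?J" if "f \<in> ?J" "g \<in> ?J" for f g
      using that by (simp add: path_algebra_simps order_trans[OF keys_add])
  qed
  fix f x assume f: "f \<in> ?J" and x: "x \<in> carrier ?P"
  show "x \<otimes>\<^bsub>?P\<^esub> f \<in> ?J"
  proof (clarsimp simp: path_algebra_simps)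
    fix u es assume "(u, es) \<in> keys (path_mult Q x f)"
    then obtain p q where "(u, es) = (path_source p, snd p @ snd q)" "p \<in> keys x" "q \<in> keys f"
      "path_target Q p = path_source q" using keys_path_mult[of Q x f] by blast
    then show "(u, es) \<in> N" using f x left[of p q] by (auto simp: path_algebra_simps)
  qed
  show "f \<otimes>\<^bsub>?P\<^esub> x \<in> ?J"
  proof (clarsimp simp: path_algebra_simps)
    fix u es assume "(u, es) \<in> keys (path_mult Q f x)"
    then obtain p q where "(u, es) = (path_source p, snd p @ snd q)" "p \<in> keys f" "q \<in> keys x"
      "path_target Q p = path_source q" using keys_path_mult[of Q f x] by blast
    then show "(u, es) \<in> N" using f x right[of p q] by (auto simp: path_algebra_simps)
  qed
qed

text \<open>
  The features of an ideal generated by paths of length at least two that matter below: membership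
  can be tested path by path, and no stationary path or arrow belongs to the ideal.
\<close>

locale monomial_quotient =
  fixes Q :: "('v, 'e) pre_digraph" and I :: "(('v, 'e) path \<Rightarrow>\<^sub>0 'k::field) set"
  assumes fin_digraph: "fin_digraph Q"
    and ideal: "ideal I (path_algebra Q)"
    and monomial: "f \<in> I \<Longrightarrow> p \<in> keys f \<Longrightarrow> path_elem p \<in> I"
    and length_ge_2: "path_elem p \<in> I \<Longrightarrow> 2 \<le> path_length p"

text \<open>
  Both features come from minimality of the generated ideal: the span of the paths lying in \<open>I\<close> and
  the span of all paths of length at least two are ideals containing the generators.
\<close>

lemma monomial_quotient_Idl:
  fixes Q :: "('v, 'e) pre_digraph" and I :: "(('v, 'e) path \<Rightarrow>\<^sub>0 'k::field) set"
  assumes Q: "fin_digraph Q" and R: "R \<subseteq> {p \<in> paths Q. path_length p \<ge> 2}"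
    and I: "I = Idl\<^bsub>path_algebra Q\<^esub> (path_elem ` R)"
  shows "monomial_quotient Q I"
proof -
  let ?P = "path_algebra Q :: ('k, ('v, 'e) path \<Rightarrow>\<^sub>0 'k) module"
  interpret ring ?P by (rule path_algebra_ring[OF Q])
  have gens: "path_elem ` R \<subseteq> carrier ?P"
    using R by (auto simp: path_algebra_simps path_elem_def)
  interpret I: ideal I ?P unfolding I by (rule genideal_ideal[OF gens])
  have RI: "path_elem ` R \<subseteq> I" unfolding I by (rule genideal_self[OF gens])
  have product: "path_elem (path_source p, snd p @ snd q) = (path_elem p :: _ \<Rightarrow>\<^sub>0 'k) \<otimes>\<^bsub>?P\<^esub> path_elem q"
    if "path_target Q p = path_source q" for p q :: "('v, 'e) path"
    using that by (simp add: path_algebra_simps path_elem_def path_mult_single)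
  let ?N = "{p \<in> paths Q. path_elem p \<in> I}"
  have carrier: "path_elem p \<in> carrier ?P" if "p \<in> paths Q" for p
    using that by (simp add: path_algebra_simps path_elem_def)
  have "ideal {f. keys f \<subseteq> ?N} ?P"
    by (rule ideal_of_keys[OF Q])
       (auto simp: paths_append product carrier I.I_l_closed I.I_r_closed)
  then have "I \<subseteq> {f. keys f \<subseteq> ?N}"
    unfolding I
  proof (rule genideal_minimal)
    show "path_elem ` R \<subseteq> {f. keys f \<subseteq> {p \<in> paths Q. path_elem p \<in> Idl\<^bsub>?P\<^esub> (path_elem ` R)}}"
      using R RI unfolding I by (auto simp: keys_single path_elem_def)
  qed
  moreover have "ideal {f. keys f \<subseteq> {p \<in> paths Q. path_length p \<ge> 2}} ?P"
    by (rule ideal_of_keys[OF Q]) (use paths_append in \<open>auto simp: path_length_def\<close>)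
  then have "I \<subseteq> {f. keys f \<subseteq> {p \<in> paths Q. path_length p \<ge> 2}}"
    unfolding I by (rule genideal_minimal) (use R in \<open>auto simp: path_elem_def\<close>)
  ultimately show ?thesis
    using Q I.ideal_axioms by (intro monomial_quotient.intro) (auto simp: path_elem_def)
qed

context monomial_quotient
begin

abbreviation P where "P \<equiv> path_algebra Q :: ('k, ('v, 'e) path \<Rightarrow>\<^sub>0 'k) module"
abbreviation A where "A \<equiv> quot_algebra Q I"

sublocale I: ideal I P by (rule ideal)

lemma path_algebra_minus: 
  assumes "keys f \<subseteq> paths Q"
  shows "\<ominus>\<^bsub>P\<^esub> f = - f"
  by (rule I.minus_equality) (use assms in \<open>auto simp: path_algebra_simps\<close>)

lemma I_keys: "f \<in> I \<Longrightarrow> keys f \<subseteq> paths Q"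
  using I.Icarr[of f] by (simp add: path_algebra_simps)

lemma I_zero: "0 \<in> I"
  using additive_subgroup.zero_closed[OF I.is_additive_subgroup] by (simp add: path_algebra_simps)

lemma I_add: "f \<in> I \<Longrightarrow> g \<in> I \<Longrightarrow> f + g \<in> I"
  using additive_subgroup.a_closed[OF I.is_additive_subgroup, of f g] by (simp add: path_algebra_simps)

text \<open>Scalars act as elements of the ring, by \<open>c f = (c \<cdot> 1) f\<close>.\<close>

lemma I_scale:
  assumes "f \<in> I" shows "c *s f \<in> I"
proof -
  have "keys (c *s \<one>\<^bsub>P\<^esub>) \<subseteq> paths Q"
    using I.one_closed by (intro keys_scale) (simp only: path_algebra_simps mem_Collect_eq)
  then have "(c *s \<one>\<^bsub>P\<^esub>) \<otimes>\<^bsub>P\<^esub> f \<in> I"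
    using assms by (intro I.I_l_closed) (auto simp only: path_algebra_simps)
  moreover have "\<one>\<^bsub>P\<^esub> \<otimes>\<^bsub>P\<^esub> f = f" using I.Icarr[OF assms] by (rule I.l_one)
  ultimately show ?thesis
    by (simp only: path_algebra_simps(2) path_mult_scale_left)
qed

lemma I_sum: "(\<And>k. k \<in> K \<Longrightarrow> h k \<in> I) \<Longrightarrow> sum h K \<in> I"
  by (induction K rule: infinite_finite_induct) (auto simp: I_zero I_add)

lemma single_in_I: "path_elem p \<in> I \<Longrightarrow> single p c \<in> I"
  using I_scale[of "path_elem p" c] by (simp add: path_elem_def scale_single)

lemma coset_eq_iff:
  assumes "keys f \<subseteq> paths Q" "keys g \<subseteq> paths Q"
  shows "coset Q I f = coset Q I g \<longleftrightarrow> f - g \<in> I"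
proof -
  have "f \<ominus>\<^bsub>P\<^esub> g = f - g"
    using assms by (simp add: a_minus_def path_algebra_minus path_algebra_simps)
  then show ?thesis
    using I.quotient_eq_iff_same_a_r_cos[OF ideal, of f g] assms
    by (simp add: coset_def path_algebra_simps)
qed

lemma coset_mem_iff:
  "g \<in> coset Q I f \<longleftrightarrow> g - f \<in> I"
  by (auto simp: coset_def a_r_coset_def' path_algebra_simps intro: bexI[of _ "g - f"])

lemma quot_algebra_carrier: "carrier A = coset Q I ` {f. keys f \<subseteq> paths Q}"
  by (auto simp: quot_algebra_def ring.defs FactRing_def A_RCOSETS_def' coset_def path_algebra_simps)

lemma quot_carrierE:
  assumes "x \<in> carrier A" obtains f where "keys f \<subseteq> paths Q" "x = coset Q I f"
  using assms by (auto simp: quot_algebra_carrier)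

lemma coset_in_carrier: "keys f \<subseteq> paths Q \<Longrightarrow> coset Q I f \<in> carrier A"
  by (auto simp: quot_algebra_carrier)

lemma coset_add:
  assumes "keys f \<subseteq> paths Q" "keys g \<subseteq> paths Q"
  shows "coset Q I f \<oplus>\<^bsub>A\<^esub> coset Q I g = coset Q I (f + g)"
  using I.a_rcos_sum[of f g] assms
  by (simp add: quot_algebra_def ring.defs FactRing_def coset_def path_algebra_simps)

lemma coset_mult:
  assumes "keys f \<subseteq> paths Q" "keys g \<subseteq> paths Q"
  shows "coset Q I f \<otimes>\<^bsub>A\<^esub> coset Q I g = coset Q I (path_mult Q f g)"
  using I.rcoset_mult_add[of f g] assms
  by (simp add: quot_algebra_def ring.defs FactRing_def coset_def path_algebra_simps)

lemma quot_zero: "\<zero>\<^bsub>A\<^esub> = coset Q I 0"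
  using I.a_rcos_zero[OF ideal I_zero]
  by (simp add: quot_algebra_def ring.defs FactRing_def coset_def)

lemma coset_eq_zero_iff: "keys f \<subseteq> paths Q \<Longrightarrow> coset Q I f = \<zero>\<^bsub>A\<^esub> \<longleftrightarrow> f \<in> I"
  by (simp add: quot_zero coset_eq_iff)

lemma coset_smult:
  assumes "keys f \<subseteq> paths Q"
  shows "c \<odot>\<^bsub>A\<^esub> coset Q I f = coset Q I (c *s f)"
proof -
  have "coset Q I (c *s g) = coset Q I (c *s f)" if "g \<in> coset Q I f" for g
  proof -
    have "g - f \<in> I" using that by (simp add: coset_mem_iff)
    then have "c *s g - c *s f \<in> I" using I_scale[of "g - f" c] by (simp add: scale_diff)
    moreover have "keys g \<subseteq> paths Q"
      using I_keys[OF \<open>g - f \<in> I\<close>] assms keys_add[of "g - f" f] by auto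
    ultimately show ?thesis using assms by (simp add: coset_eq_iff keys_scale)
  qed
  moreover have "f \<in> coset Q I f" by (simp add: coset_mem_iff I_zero)
  ultimately have "(\<Union>g\<in>coset Q I f. coset Q I (c *s g)) = coset Q I (c *s f)" by blast
  then show ?thesis
    by (simp add: quot_algebra_def ring.defs module.defs coset_def path_algebra_simps)
qed

sublocale A: ring A
  unfolding quot_algebra_def by (rule ring_extend[OF I.quotient_is_ring])

lemma coset_minus:
  assumes "keys f \<subseteq> paths Q"
  shows "\<ominus>\<^bsub>A\<^esub> coset Q I f = coset Q I (- f)"
  by (rule A.minus_equality) (use assms in \<open>auto simp: coset_add quot_zero intro!: coset_in_carrier\<close>)

lemma keys_sum_subset:
  "(\<And>k. k \<in> K \<Longrightarrow> keys (h k) \<subseteq> S) \<Longrightarrow> keys (sum h K) \<subseteq> S"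
  by (induction K rule: infinite_finite_induct) (auto simp: order_trans[OF keys_add])

lemma coset_sum:
  assumes "finite K" "\<And>k. k \<in> K \<Longrightarrow> keys (h k) \<subseteq> paths Q"
  shows "(\<Oplus>\<^bsub>A\<^esub> k\<in>K. coset Q I (h k)) = coset Q I (sum h K)"
  using assms
proof (induction K)
  case (insert k K)
  then show ?case
    by (subst A.finsum_insert) (auto simp: coset_add keys_sum_subset coset_in_carrier)
qed (simp add: quot_zero)

lemma basis_paths_subset: "basis_paths Q I \<subseteq> paths Q"
  by (auto simp: basis_paths_def)

lemma short_path_in_basis: "p \<in> paths Q \<Longrightarrow> path_length p < 2 \<Longrightarrow> p \<in> basis_paths Q I"
  using length_ge_2[of p] by (auto simp: basis_paths_def)

lemma arrow_in_basis: "a \<in> arcs Q \<Longrightarrow> arrow Q a \<in> basis_paths Q I"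
  by (rule short_path_in_basis) (auto simp: arrow_in_paths fin_digraph, simp add: arrow_def path_length_def)

section \<open>Coordinates with respect to the nonzero paths\<close>

lemma lookup_eq_of_diff_in_I:
  assumes "f - g \<in> I" "p \<in> basis_paths Q I"
  shows "lookup f p = lookup g p"
  using monomial[OF assms(1), of p] assms(2) by (auto simp: basis_paths_def in_keys_iff lookup_minus)

lemma coords_coset:
  assumes "keys f \<subseteq> basis_paths Q I"
  shows "coords Q I (coset Q I f) = f"
  unfolding coords_def
proof (rule the_equality)
  fix g assume g: "g \<in> coset Q I f \<and> keys g \<subseteq> basis_paths Q I"
  then have d: "g - f \<in> I" by (simp add: coset_mem_iff)
  show "g = f"
  proof (rule poly_mapping_eqI)
    fix p show "lookup g p = lookup f p"
    proof (cases "p \<in> basis_paths Q I")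
      case False
      then have "p \<notin> keys g" "p \<notin> keys f" using g assms by auto
      then show ?thesis by (simp add: in_keys_iff)
    qed (rule lookup_eq_of_diff_in_I[OF d])
  qed
qed (use assms in \<open>auto simp: coset_mem_iff I_zero\<close>)

lemma ex_basis_representative:
  assumes "keys f \<subseteq> paths Q"
  shows "\<exists>g. keys g \<subseteq> basis_paths Q I \<and> f - g \<in> I"
  using assms
proof (induction f rule: keys_subset_induct)
  case zero
  show ?case by (rule exI[of _ 0]) (simp add: I_zero)
next
  case (single p c)
  show ?case
  proof (cases "path_elem p \<in> I")
    case True
    then show ?thesis by (intro exI[of _ 0]) (simp add: single_in_I)
  next
    case False
    then show ?thesis using single
      by (intro exI[of _ "single p c"]) (simp add: I_zero basis_paths_def)
  qed
next
  case (add f g)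
  then obtain f' g' where "keys f' \<subseteq> basis_paths Q I" "f - f' \<in> I"
    "keys g' \<subseteq> basis_paths Q I" "g - g' \<in> I" by blast
  then show ?case
    using I_add[of "f - f'" "g - g'"]
    by (intro exI[of _ "f' + g'"]) (simp add: order_trans[OF keys_add] algebra_simps)
qed

text \<open>
  Coordinates in \<open>A\<close> can be read off from any representative, because changing the representative
  alters only the coefficients of paths in \<open>I\<close>.
\<close>

lemma lookup_coords_coset:
  assumes "keys f \<subseteq> paths Q" "p \<in> basis_paths Q I"
  shows "lookup (coords Q I (coset Q I f)) p = lookup f p"
proof -
  obtain g where g: "keys g \<subseteq> basis_paths Q I" "f - g \<in> I"
    using ex_basis_representative[OF assms(1)] by blast
  then have "coset Q I f = coset Q I g"
    using assms basis_paths_subset by (subst coset_eq_iff) auto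
  then show ?thesis using lookup_eq_of_diff_in_I[OF g(2) assms(2)] coords_coset[OF g(1)] by simp
qed

lemma quot_carrier_basisE:
  assumes "x \<in> carrier A"
  obtains f where "keys f \<subseteq> basis_paths Q I" "x = coset Q I f"
proof -
  obtain f where f: "keys f \<subseteq> paths Q" "x = coset Q I f"
    using assms by (rule quot_carrierE)
  obtain g where g: "keys g \<subseteq> basis_paths Q I" "f - g \<in> I"
    using ex_basis_representative[OF f(1)] by blast
  then have "coset Q I f = coset Q I g"
    using f basis_paths_subset by (subst coset_eq_iff) auto
  then show ?thesis using that g f by simp
qed



lemma arrow_paths: "a \<in> arcs Q \<Longrightarrow> arrow Q a \<in> paths Q"
  by (rule arrow_in_paths[OF fin_digraph])

lemma keys_path_elem: "p \<in> S \<Longrightarrow> keys (path_elem p :: ('v, 'e) path \<Rightarrow>\<^sub>0 'k) \<subseteq> S"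
  by (simp add: path_elem_def)

lemma keys_single_paths: "p \<in> paths Q \<Longrightarrow> keys (single p (c::'k)) \<subseteq> paths Q"
  by simp

lemma keys_path_mult_paths:
  assumes "keys f \<subseteq> paths Q" "keys g \<subseteq> paths Q"
  shows "keys (path_mult Q f g :: ('v, 'e) path \<Rightarrow>\<^sub>0 'k) \<subseteq> paths Q"
  using I.m_closed[of f g] assms by (simp add: path_algebra_simps)

lemma I_mult_left:
  assumes "keys f \<subseteq> paths Q" "g \<in> I" shows "path_mult Q f g \<in> I"
  using I.I_l_closed[of g f] assms by (simp add: path_algebra_simps)

lemma I_mult_right:
  assumes "keys f \<subseteq> paths Q" "g \<in> I" shows "path_mult Q g f \<in> I"
  using I.I_r_closed[of g f] assms by (simp add: path_algebra_simps)

section \<open>Multiplication with maximal paths\<close>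

lemma left_maximal_iff:
  "left_maximal Q I p \<longleftrightarrow> p \<in> basis_paths Q I \<and>
     (\<forall>a \<in> arcs Q. path_mult Q (path_elem (arrow Q a)) (path_elem p) \<in> I)"
proof (cases "p \<in> basis_paths Q I")
  case True
  then have "keys (path_elem p :: ('v, 'e) path \<Rightarrow>\<^sub>0 'k) \<subseteq> paths Q"
    using basis_paths_subset by (intro keys_path_elem) auto
  then show ?thesis
    by (simp add: left_maximal_def coset_mult coset_eq_zero_iff keys_path_elem arrow_paths
      keys_path_mult_paths)
qed (simp add: left_maximal_def)

lemma right_maximal_iff:
  "right_maximal Q I p \<longleftrightarrow> p \<in> basis_paths Q I \<and>
     (\<forall>a \<in> arcs Q. path_mult Q (path_elem p) (path_elem (arrow Q a)) \<in> I)"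
proof (cases "p \<in> basis_paths Q I")
  case True
  then have "keys (path_elem p :: ('v, 'e) path \<Rightarrow>\<^sub>0 'k) \<subseteq> paths Q"
    using basis_paths_subset by (intro keys_path_elem) auto
  then show ?thesis
    by (simp add: right_maximal_def coset_mult coset_eq_zero_iff keys_path_elem arrow_paths
      keys_path_mult_paths)
qed (simp add: right_maximal_def)

lemma path_Cons_eq_mult:
  assumes "(u, a # es) \<in> paths Q"
  shows "a \<in> arcs Q" "(head Q a, es) \<in> paths Q"
    "single (u, a # es) c = path_mult Q (path_elem (arrow Q a)) (single (head Q a, es) (c::'k))"
proof -
  interpret fin_digraph Q by (rule fin_digraph)
  show *: "a \<in> arcs Q" "(head Q a, es) \<in> paths Q"
    using assms by (auto simp: paths_def path_source_def path_target_def awalk_Cons_iff awalk_Nil_iff split: if_splits)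
  have "u = tail Q a" using assms by (auto simp: paths_def path_source_def awalk_Cons_iff)
  then show "single (u, a # es) c = path_mult Q (path_elem (arrow Q a)) (single (head Q a, es) c)"
    by (simp add: path_elem_def path_mult_single arrow_def path_source_def path_target_def)
qed

lemma path_snoc_eq_mult:
  assumes "(u, es @ [a]) \<in> paths Q"
  shows "a \<in> arcs Q" "(u, es) \<in> paths Q"
    "single (u, es @ [a]) c = path_mult Q (single (u, es) (c::'k)) (path_elem (arrow Q a))"
proof -
  interpret fin_digraph Q by (rule fin_digraph)
  have "awalk u (es @ [a]) (head Q a)"
    using assms by (simp add: paths_def path_source_def path_target_def)
  then obtain *: "a \<in> arcs Q" "awalk u es (tail Q a)"
    by (auto simp: awalk_Cons_iff)
  then have t: "path_target Q (u, es) = tail Q a"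
    by (cases es rule: rev_cases) (auto simp: path_target_def awalk_Nil_iff awalk_Cons_iff)
  show "a \<in> arcs Q" "(u, es) \<in> paths Q" using * t by (auto simp: paths_def path_source_def)
  show "single (u, es @ [a]) c = path_mult Q (single (u, es) (c::'k)) (path_elem (arrow Q a))"
    using t by (simp add: path_elem_def path_mult_single arrow_def path_source_def)
qed

text \<open>
  A path of positive length ends in an arrow, and this arrow already annihilates \<open>p\<close> modulo \<open>I\<close>.
  Among the stationary paths only the one at the source of \<open>p\<close> contributes.
\<close>

lemma mult_left_maximal:
  assumes p: "left_maximal Q I p" and f: "keys f \<subseteq> paths Q"
  shows "path_mult Q f (path_elem p) -
     lookup f (stationary (path_source p)) *s path_elem p \<in> I"
  using f
proof (induction f rule: keys_subset_induct)
  case zero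
  then show ?case by (simp add: I_zero)
next
  case (single q c)
  show ?case
  proof (cases "snd q" rule: rev_cases)
    case Nil
    then obtain u where "q = (u, [])" by (cases q) auto
    then show ?thesis
      by (auto simp: path_elem_def path_mult_single lookup_single when_def stationary_def path_target_def
        path_source_def scale_single I_zero)
  next
    case (snoc es a)
    obtain u where q: "q = (u, es @ [a])" using snoc by (cases q) auto
    have "path_mult Q (single q c) (path_elem p) =
      path_mult Q (single (u, es) c) (path_mult Q (path_elem (arrow Q a)) (path_elem p))"
      using path_snoc_eq_mult(3)[of u es a c] single q by (simp add: path_mult_assoc)
    also have "\<dots> \<in> I"
      using path_snoc_eq_mult(1,2)[of u es a] single q p
      by (intro I_mult_left[OF keys_single_paths]) (auto simp: left_maximal_iff)
    finally show ?thesis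
      by (simp add: q stationary_def lookup_single)
  qed
next
  case (add f g)
  then show ?case using I_add[OF add.IH]
    by (simp add: path_mult_add_left lookup_add scale_add_left algebra_simps)
qed

lemma mult_right_maximal:
  assumes p: "right_maximal Q I p" and f: "keys f \<subseteq> paths Q"
  shows "path_mult Q (path_elem p) f -
     lookup f (stationary (path_target Q p)) *s path_elem p \<in> I"
  using f
proof (induction f rule: keys_subset_induct)
  case zero
  then show ?case by (simp add: I_zero)
next
  case (single q c)
  show ?case
  proof (cases "snd q")
    case Nil
    then obtain u where "q = (u, [])" by (cases q) auto
    then show ?thesis
      by (auto simp: path_elem_def path_mult_single lookup_single when_def stationary_def 
        path_source_def scale_single I_zero)
  next
    case (Cons a es)
    obtain u where q: "q = (u, a # es)" using Cons by (cases q) auto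
    have "path_mult Q (path_elem p) (single q c) =
      path_mult Q (path_mult Q (path_elem p) (path_elem (arrow Q a))) (single (head Q a, es) c)"
      using path_Cons_eq_mult(3)[of u a es c] single q by (simp add: path_mult_assoc)
    also have "\<dots> \<in> I"
      using path_Cons_eq_mult(1,2)[of u a es] single q p
      by (intro I_mult_right[OF keys_single_paths]) (auto simp: right_maximal_iff)
    finally show ?thesis
      by (simp add: q stationary_def lookup_single)
  qed
next
  case (add f g)
  then show ?case using I_add[OF add.IH]
    by (simp add: path_mult_add_right lookup_add scale_add_left algebra_simps)
qed

definition maximal_parallel :: "'e \<Rightarrow> ('v, 'e) path set" where
  "maximal_parallel a = {p. maximal_path Q I p \<and> parallel Q p (arrow Q a)}"

lemma maximal_parallel_subset: "maximal_parallel a \<subseteq> basis_paths Q I"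
  by (auto simp: maximal_parallel_def maximal_path_def left_maximal_def)

lemma path_source_arrow: "path_source (arrow Q a) = tail Q a"
  and path_target_arrow: "path_target Q (arrow Q a) = head Q a"
  by (simp_all add: arrow_def path_source_def path_target_def)

text \<open>
  A maximal path parallel to \<open>a\<close> has the same ends as \<open>a\<close>, so the scalars by which elements act on
  it depend on \<open>a\<close> only and are common to all terms of \<open>Y\<close>.
\<close>

lemma mult_maximal_parallel:
  assumes Y: "keys Y \<subseteq> maximal_parallel a" and f: "keys f \<subseteq> paths Q"
  shows "path_mult Q f Y - lookup f (stationary (tail Q a)) *s Y \<in> I"
    and "path_mult Q Y f - lookup f (stationary (head Q a)) *s Y \<in> I"
proof -
  have "path_mult Q f Y - lookup f (stationary (tail Q a)) *s Y \<in> I \<and>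
    path_mult Q Y f - lookup f (stationary (head Q a)) *s Y \<in> I"
    using Y
  proof (induction Y rule: keys_subset_induct)
    case zero
    then show ?case by (simp add: I_zero)
  next
    case (single p c)
    then have p: "left_maximal Q I p" "right_maximal Q I p" "path_source p = tail Q a" "path_target Q p = head Q a"
      by (auto simp: maximal_parallel_def maximal_path_def parallel_def path_source_arrow path_target_arrow)
    have s: "single p c = c *s path_elem p" by (simp add: path_elem_def scale_single)
    show ?case
      using I_scale[OF mult_left_maximal[OF p(1) f], of c] I_scale[OF mult_right_maximal[OF p(2) f], of c]
      unfolding s p by (simp add: path_mult_scale_left path_mult_scale_right scale_diff scale_scale mult.commute[of _ c])
  next
    case (add Y Z)
    then show ?case
      using I_add[OF add.IH(1)[THEN conjunct1] add.IH(2)[THEN conjunct1]]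
        I_add[OF add.IH(1)[THEN conjunct2] add.IH(2)[THEN conjunct2]]
      by (simp add: path_mult_add_right path_mult_add_left scale_add algebra_simps)
  qed
  then show "path_mult Q f Y - lookup f (stationary (tail Q a)) *s Y \<in> I"
    and "path_mult Q Y f - lookup f (stationary (head Q a)) *s Y \<in> I" by auto
qed

section \<open>The derivations defined by maximal paths\<close>

text \<open>
  Replacing one occurrence of an arrow in a longer path by a maximal path gives zero in the
  quotient.  This is why a derivation that vanishes on stationary paths and sends each arrow \<open>a\<close> to
  a combination \<open>Y a\<close> of maximal paths sees only the coefficients at the arrows themselves.
\<close>

definition arrow_subst :: "('e \<Rightarrow> ('v, 'e) path \<Rightarrow>\<^sub>0 'k) \<Rightarrow> (('v, 'e) path \<Rightarrow>\<^sub>0 'k) \<Rightarrow> ('v, 'e) path \<Rightarrow>\<^sub>0 'k" where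
  "arrow_subst Y f = (\<Sum>a\<in>arcs Q. lookup f (arrow Q a) *s Y a)"

text \<open>
  The restriction to the carrier makes this the same function as a derivation that is described
  among the extensional ones.
\<close>

definition quot_arrow_subst where
  "quot_arrow_subst Y = (\<lambda>x\<in>carrier A. coset Q I (arrow_subst Y (coords Q I x)))"

lemma quot_arrow_subst_coset:
  assumes "keys f \<subseteq> paths Q"
  shows "quot_arrow_subst Y (coset Q I f) = coset Q I (arrow_subst Y f)"
proof -
  have "arrow_subst Y (coords Q I (coset Q I f)) = arrow_subst Y f"
    unfolding arrow_subst_def
    by (intro sum.cong) (simp_all add: lookup_coords_coset assms arrow_in_basis)
  then show ?thesis using assms by (simp add: quot_arrow_subst_def coset_in_carrier)
qed

lemma keys_arrow_subst:
  assumes "\<And>a. a \<in> arcs Q \<Longrightarrow> keys (Y a) \<subseteq> S"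
  shows "keys (arrow_subst Y f) \<subseteq> S"
  unfolding arrow_subst_def by (intro keys_sum_subset keys_scale assms)

lemma finite_arcs: "finite (arcs Q)"
  using fin_digraph by (simp add: fin_digraph_def fin_digraph_axioms_def)

text \<open>
  The Leibniz rule modulo \<open>I\<close>.  The coefficient of the product of \<open>f\<close> and \<open>g\<close> at the arrow \<open>a\<close> has
  two summands; modulo \<open>I\<close> they account for multiplying \<open>Y a\<close> by \<open>f\<close> from the left and by \<open>g\<close>
  from the right.
\<close>

lemma arrow_subst_product:
  assumes Y: "\<And>a. a \<in> arcs Q \<Longrightarrow> keys (Y a) \<subseteq> maximal_parallel a"
    and f: "keys f \<subseteq> paths Q" and g: "keys g \<subseteq> paths Q"
  shows "path_mult Q (arrow_subst Y f) g + path_mult Q f (arrow_subst Y g) - arrow_subst Y (path_mult Q f g) \<in> I"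
proof -
  have "path_mult Q (arrow_subst Y f) g + path_mult Q f (arrow_subst Y g) - arrow_subst Y (path_mult Q f g) =
    (\<Sum>a\<in>arcs Q.
      lookup f (arrow Q a) *s (path_mult Q (Y a) g - lookup g (stationary (head Q a)) *s Y a) +
      lookup g (arrow Q a) *s (path_mult Q f (Y a) - lookup f (stationary (tail Q a)) *s Y a))"
    unfolding arrow_subst_def path_mult_sum_left path_mult_sum_right sum_subtractf[symmetric] sum.distrib[symmetric]
    by (intro sum.cong refl)
       (simp add: path_mult_scale_left path_mult_scale_right lookup_path_mult_arrow
         scale_diff scale_scale scale_add_left mult.commute)
  also have "\<dots> \<in> I"
    by (intro I_sum I_add I_scale mult_maximal_parallel Y f g)
  finally show ?thesis .
qed

lemma quot_arrow_subst_derivation: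
  assumes Y: "\<And>a. a \<in> arcs Q \<Longrightarrow> keys (Y a) \<subseteq> maximal_parallel a"
  shows "derivation A (quot_arrow_subst Y)"
proof -
  have paths: "keys (arrow_subst Y f) \<subseteq> paths Q" for f
    by (rule keys_arrow_subst) (use Y maximal_parallel_subset basis_paths_subset in blast)
  have add: "arrow_subst Y (f + g) = arrow_subst Y f + arrow_subst Y g" for f g
    by (simp add: arrow_subst_def lookup_add scale_add_left sum.distrib)
  have smul: "arrow_subst Y (c *s f) = c *s arrow_subst Y f" for c f
    by (simp add: arrow_subst_def lookup_scale scale_sum scale_scale)
  note closed = order_trans[OF keys_add Un_least] keys_path_mult_paths keys_scale
  show ?thesis
    unfolding derivation_def
  proof (intro conjI ballI allI)
    show "quot_arrow_subst Y \<in> carrier A \<rightarrow> carrier A"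
      by (auto simp: quot_arrow_subst_coset paths coset_in_carrier elim!: quot_carrierE)
  next
    fix x y assume x: "x \<in> carrier A" and y: "y \<in> carrier A"
    obtain f where "keys f \<subseteq> paths Q" "x = coset Q I f" using x by (rule quot_carrierE)
    moreover obtain g where "keys g \<subseteq> paths Q" "y = coset Q I g" using y by (rule quot_carrierE)
    ultimately show "quot_arrow_subst Y (x \<oplus>\<^bsub>A\<^esub> y) = quot_arrow_subst Y x \<oplus>\<^bsub>A\<^esub> quot_arrow_subst Y y"
      by (simp add: quot_arrow_subst_coset paths coset_add closed add)
  next
    fix c x assume "x \<in> carrier A"
    then show "quot_arrow_subst Y (c \<odot>\<^bsub>A\<^esub> x) = c \<odot>\<^bsub>A\<^esub> quot_arrow_subst Y x"
      by (auto simp: quot_arrow_subst_coset paths coset_smult closed smul elim!: quot_carrierE)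
  next
    fix x y assume x: "x \<in> carrier A" and y: "y \<in> carrier A"
    obtain f g where fg: "keys f \<subseteq> paths Q" "x = coset Q I f" "keys g \<subseteq> paths Q" "y = coset Q I g"
      using quot_carrierE[OF x] quot_carrierE[OF y] by metis
    have "coset Q I (path_mult Q (arrow_subst Y f) g + path_mult Q f (arrow_subst Y g)) =
      coset Q I (arrow_subst Y (path_mult Q f g))"
      using arrow_subst_product[OF Y fg(1,3)] fg by (subst coset_eq_iff) (simp_all add: closed paths)
    then show "quot_arrow_subst Y (x \<otimes>\<^bsub>A\<^esub> y) = quot_arrow_subst Y x \<otimes>\<^bsub>A\<^esub> y \<oplus>\<^bsub>A\<^esub> x \<otimes>\<^bsub>A\<^esub> quot_arrow_subst Y y"
      using fg by (simp add: quot_arrow_subst_coset paths coset_mult coset_add closed)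
  qed
qed

text \<open>Arrows and stationary paths generate \<open>A\<close>.\<close>

lemma derivation_eqI:
  assumes d: "derivation A d" and d': "derivation A d'"
    and arrows: "\<And>a. a \<in> arcs Q \<Longrightarrow> d (path_class Q I (arrow Q a)) = d' (path_class Q I (arrow Q a))"
    and verts: "\<And>v. v \<in> verts Q \<Longrightarrow> d (path_class Q I (stationary v)) = d' (path_class Q I (stationary v))"
    and x: "x \<in> carrier A"
  shows "d x = d' x"
proof -
  have path: "d (path_class Q I (u, es)) = d' (path_class Q I (u, es))" if "(u, es) \<in> paths Q" for u es
    using that
  proof (induction es arbitrary: u)
    case Nil
    then show ?case using verts[of u] path_source_in_verts[OF Nil] by (simp add: stationary_def path_source_def)
  next
    case (Cons a es)
    note C = path_Cons_eq_mult[OF Cons.prems]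
    have k: "keys (path_elem (arrow Q a) :: ('v, 'e) path \<Rightarrow>\<^sub>0 'k) \<subseteq> paths Q"
      "keys (path_elem (head Q a, es) :: ('v, 'e) path \<Rightarrow>\<^sub>0 'k) \<subseteq> paths Q"
      using C(1,2) arrow_paths by (auto intro!: keys_path_elem)
    have "path_class Q I (u, a # es) = path_class Q I (arrow Q a) \<otimes>\<^bsub>A\<^esub> path_class Q I (head Q a, es)"
      using k by (simp add: coset_mult) (simp add: C(3)[of 1] path_elem_def)
    then show ?case
      using d d' k Cons.IH[OF C(2)] arrows[OF C(1)] by (simp add: derivation_def coset_in_carrier)
  qed
  obtain f where f: "keys f \<subseteq> paths Q" "x = coset Q I f" using x by (rule quot_carrierE)
  have "d (coset Q I f) = d' (coset Q I f)"
    using f(1)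
  proof (induction f rule: keys_subset_induct)
    case zero
    have zero: "coset Q I 0 \<in> carrier A" by (simp add: coset_in_carrier)
    have scale_zero: "0 \<odot>\<^bsub>A\<^esub> z = coset Q I 0" if "z \<in> carrier A" for z
      using that by (rule quot_carrierE) (simp add: coset_smult)
    have at_zero: "e (coset Q I 0) = coset Q I 0" if e: "derivation A e" for e
    proof -
      have closed: "e (coset Q I 0) \<in> carrier A"
        using e zero unfolding derivation_def by blast
      have "e (0 \<odot>\<^bsub>A\<^esub> coset Q I 0) = 0 \<odot>\<^bsub>A\<^esub> e (coset Q I 0)"
        using e zero unfolding derivation_def by blast
      then show ?thesis unfolding scale_zero[OF zero] scale_zero[OF closed] .
    qed
    show ?case by (simp only: at_zero[OF d] at_zero[OF d'])
  next
    case (single p c)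
    have "coset Q I (single p c) = c \<odot>\<^bsub>A\<^esub> path_class Q I p"
      using single by (simp add: coset_smult path_elem_def scale_single)
    then show ?case using d d' path[of "fst p" "snd p"] single
      by (simp add: derivation_def coset_in_carrier keys_path_elem)
  next
    case (add f g)
    then show ?case using d d' by (simp add: derivation_def coset_in_carrier flip: coset_add)
  qed
  then show ?thesis using f by simp
qed

lemma arrow_subst_arrow:
  assumes "a \<in> arcs Q" shows "arrow_subst Y (path_elem (arrow Q a)) = Y a"
proof -
  have "arrow_subst Y (path_elem (arrow Q a)) = (\<Sum>b\<in>arcs Q. if b = a then Y b else 0)"
    unfolding arrow_subst_def
    by (intro sum.cong refl)
       (auto simp: path_elem_def lookup_single when_def arrow_def intro!: poly_mapping_eqI simp: lookup_scale)
  then show ?thesis using assms finite_arcs by simp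
qed

lemma arrow_subst_stationary: "arrow_subst Y (path_elem (stationary v)) = 0"
  unfolding arrow_subst_def
  by (intro sum.neutral) (auto simp: path_elem_def lookup_single when_def arrow_def stationary_def)

lemma arrow_subst_single_arrow:
  assumes "a \<in> arcs Q"
  shows "arrow_subst (\<lambda>b. if b = a then z else 0) f = lookup f (arrow Q a) *s z"
proof -
  have "arrow_subst (\<lambda>b. if b = a then z else 0) f = (\<Sum>b\<in>arcs Q. if b = a then lookup f (arrow Q a) *s z else 0)"
    unfolding arrow_subst_def by (intro sum.cong) auto
  then show ?thesis using assms finite_arcs by simp
qed

text \<open>
  The description of \<open>\<delta>\<^bsub>(a,p)\<^esub>\<close> by its values on generators is satisfied by reading off the
  coordinate at \<open>a\<close>, and it determines the derivation by \<open>derivation_eqI\<close>.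
\<close>

lemma path_derivation_maximal:
  assumes a: "a \<in> arcs Q" and p: "p \<in> maximal_parallel a"
  shows "path_derivation Q I a p = quot_arrow_subst (\<lambda>b. if b = a then path_elem p else 0)"
    (is "_ = quot_arrow_subst ?Y")
  unfolding path_derivation_def
proof (rule the_equality)
  have Y: "keys (?Y b) \<subseteq> maximal_parallel b" for b
    using p by (simp add: keys_path_elem)
  have arrow: "quot_arrow_subst ?Y (path_class Q I (arrow Q b)) = coset Q I (?Y b)" if "b \<in> arcs Q" for b
    using that by (simp only: quot_arrow_subst_coset[OF keys_path_elem[OF arrow_paths]] arrow_subst_arrow)
  have vert: "quot_arrow_subst ?Y (path_class Q I (stationary v)) = \<zero>\<^bsub>A\<^esub>" if "v \<in> verts Q" for v
    using that by (simp add: quot_arrow_subst_coset keys_path_elem stationary_in_paths arrow_subst_stationary quot_zero)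
  have D: "derivation A (quot_arrow_subst ?Y)" by (rule quot_arrow_subst_derivation[OF Y])
  have "quot_arrow_subst ?Y \<in> extensional (carrier A)"
    by (simp add: quot_arrow_subst_def)
  then show "derivation A (quot_arrow_subst ?Y) \<and>
     quot_arrow_subst ?Y \<in> extensional (carrier A) \<and>
     quot_arrow_subst ?Y (path_class Q I (arrow Q a)) = path_class Q I p \<and>
     (\<forall>b\<in>arcs Q - {a}. quot_arrow_subst ?Y (path_class Q I (arrow Q b)) = \<zero>\<^bsub>A\<^esub>) \<and>
     (\<forall>v\<in>verts Q. quot_arrow_subst ?Y (path_class Q I (stationary v)) = \<zero>\<^bsub>A\<^esub>)"
    using D vert by (simp add: arrow a quot_zero)
  fix d assume d: "derivation A d \<and> d \<in> extensional (carrier A) \<and>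
         d (path_class Q I (arrow Q a)) = path_class Q I p \<and>
         (\<forall>b\<in>arcs Q - {a}. d (path_class Q I (arrow Q b)) = \<zero>\<^bsub>A\<^esub>) \<and>
         (\<forall>v\<in>verts Q. d (path_class Q I (stationary v)) = \<zero>\<^bsub>A\<^esub>)"
  show "d = quot_arrow_subst ?Y"
  proof (rule extensionalityI[of _ "carrier A"])
    show "d x = quot_arrow_subst ?Y x" if "x \<in> carrier A" for x
    proof (rule derivation_eqI[OF conjunct1[OF d] D _ _ that])
      fix b assume b: "b \<in> arcs Q"
      show "d (path_class Q I (arrow Q b)) = quot_arrow_subst ?Y (path_class Q I (arrow Q b))"
        unfolding arrow[OF b] using d b by (simp add: quot_zero)
    next
      fix v assume "v \<in> verts Q"
      then show "d (path_class Q I (stationary v)) = quot_arrow_subst ?Y (path_class Q I (stationary v))"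
        using d vert by simp
    qed
  qed (use d in \<open>simp_all add: quot_arrow_subst_def\<close>)
qed

lemma elem_derivation_maximal:
  assumes a: "a \<in> arcs Q" and z: "keys z \<subseteq> maximal_parallel a"
    and f: "keys f \<subseteq> paths Q"
  shows "elem_derivation Q I a (coset Q I z) (coset Q I f) =
    coset Q I (lookup f (arrow Q a) *s z)"
proof -
  let ?c = "lookup f (arrow Q a)"
  have zp: "keys z \<subseteq> paths Q" and zb: "keys z \<subseteq> basis_paths Q I"
    using z maximal_parallel_subset basis_paths_subset by blast+
  have "elem_derivation Q I a (coset Q I z) (coset Q I f) =
    (\<Oplus>\<^bsub>A\<^esub> p \<in> keys z. coset Q I (?c *s single p (lookup z p)))"
    unfolding elem_derivation_def coords_coset[OF zb]
  proof (rule A.finsum_cong')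
    fix p assume p: "p \<in> keys z"
    then have "keys (path_elem p :: ('v, 'e) path \<Rightarrow>\<^sub>0 'k) \<subseteq> paths Q" using zp by (intro keys_path_elem) auto
    moreover have "path_derivation Q I a p (coset Q I f) = coset Q I (?c *s path_elem p)"
      using path_derivation_maximal[OF a, of p] p z f
      by (auto simp: quot_arrow_subst_coset arrow_subst_single_arrow[OF a])
    ultimately show "lookup z p \<odot>\<^bsub>A\<^esub> path_derivation Q I a p (coset Q I f) =
      coset Q I (?c *s single p (lookup z p))"
      by (simp add: coset_smult keys_scale scale_scale) (simp add: path_elem_def scale_single mult.commute)
  qed (use zp in \<open>auto intro!: coset_in_carrier keys_scale keys_single_paths\<close>)
  also have "\<dots> = coset Q I (\<Sum>p\<in>keys z. ?c *s single p (lookup z p))"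
    by (rule coset_sum) (use zp in \<open>auto intro!: keys_scale keys_single_paths\<close>)
  also have "\<dots> = coset Q I (?c *s z)"
    by (simp flip: scale_sum poly_mapping_eq_sum_single)
  finally show ?thesis .
qed

lemma sum_elem_derivation_maximal:
  assumes Y: "\<And>a. a \<in> arcs Q \<Longrightarrow> keys (Y a) \<subseteq> maximal_parallel a"
    and y: "\<And>a. a \<in> arcs Q \<Longrightarrow> y a = coset Q I (Y a)"
    and x: "x \<in> carrier A"
  shows "(\<Oplus>\<^bsub>A\<^esub> a \<in> arcs Q. elem_derivation Q I a (y a) x) = quot_arrow_subst Y x"
proof -
  obtain f where f: "keys f \<subseteq> paths Q" "x = coset Q I f" using x by (rule quot_carrierE)
  have k: "keys (c *s Y a) \<subseteq> paths Q" if "a \<in> arcs Q" for a c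
    using Y[OF that] maximal_parallel_subset basis_paths_subset by (intro keys_scale) blast
  have "(\<Oplus>\<^bsub>A\<^esub> a \<in> arcs Q. elem_derivation Q I a (y a) x) =
    (\<Oplus>\<^bsub>A\<^esub> a \<in> arcs Q. coset Q I (lookup f (arrow Q a) *s Y a))"
    by (rule A.finsum_cong') (use Y y f k in \<open>simp_all add: elem_derivation_maximal coset_in_carrier\<close>)
  also have "\<dots> = quot_arrow_subst Y x"
    unfolding f(2) quot_arrow_subst_coset[OF f(1)] arrow_subst_def
    by (rule coset_sum[OF finite_arcs k])
  finally show ?thesis .
qed

section \<open>The exponential and the correction of the automorphism\<close>

lemma quot_smult_closed: "x \<in> carrier A \<Longrightarrow> c \<odot>\<^bsub>A\<^esub> x \<in> carrier A"
  by (erule quot_carrierE) (simp add: coset_smult coset_in_carrier keys_scale)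

lemma deriv_exp_square_zero:
  assumes d: "\<And>x. x \<in> carrier A \<Longrightarrow> d x \<in> carrier A"
    and square: "\<And>x. x \<in> carrier A \<Longrightarrow> d (d x) = \<zero>\<^bsub>A\<^esub>"
    and zero: "d \<zero>\<^bsub>A\<^esub> = \<zero>\<^bsub>A\<^esub>"
    and x: "x \<in> carrier A"
  shows "deriv_exp A d x = x \<oplus>\<^bsub>A\<^esub> d x"
proof -
  have powers: "(d ^^ Suc (Suc n)) x = \<zero>\<^bsub>A\<^esub>" for n
    by (induction n) (simp_all add: square zero x)
  have one: "1 \<odot>\<^bsub>A\<^esub> z = z" if "z \<in> carrier A" for z
    using that by (rule quot_carrierE) (simp add: coset_smult)
  have closed: "(d ^^ n) x \<in> carrier A" for n
    by (induction n) (simp_all add: d x)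
  have subset: "{n. (d ^^ n) x \<noteq> \<zero>\<^bsub>A\<^esub>} \<subseteq> {0, 1}"
  proof
    fix n assume "n \<in> {n. (d ^^ n) x \<noteq> \<zero>\<^bsub>A\<^esub>}"
    then show "n \<in> {0, 1}" using powers[of "n - 2"] by (cases n; cases "n - 1") auto
  qed
  have factor_one: "(1 / of_nat (fact n)) \<odot>\<^bsub>A\<^esub> (d ^^ n) x = (d ^^ n) x" if "n \<in> {0, 1}" for n
    using that by (elim insertE) (simp_all add: one d x)
  have "deriv_exp A d x = (\<Oplus>\<^bsub>A\<^esub> n \<in> {n. (d ^^ n) x \<noteq> \<zero>\<^bsub>A\<^esub>}. (d ^^ n) x)"
    unfolding deriv_exp_def
    by (rule A.finsum_cong') (use subset factor_one closed in \<open>auto simp del: funpow.simps\<close>)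
  also have "\<dots> = (\<Oplus>\<^bsub>A\<^esub> n \<in> {0, 1}. (d ^^ n) x)"
    by (rule A.add.finprod_mono_neutral_cong_left) (use subset closed x in \<open>auto simp del: funpow.simps\<close>)
  also have "\<dots> = x \<oplus>\<^bsub>A\<^esub> d x"
    using d x by simp
  finally show ?thesis .
qed

text \<open>
  Arrows span the part of degree one, on which the degree one component of \<open>\<phi>\<close> is the identity.
\<close>

lemma degree_one_coefficients:
  assumes \<phi>: "\<phi> \<in> Aut0 Q I" and a: "a \<in> arcs Q"
    and f: "keys f \<subseteq> basis_paths Q I" "\<phi> (path_class Q I (arrow Q a)) = coset Q I f"
    and b: "b \<in> arcs Q"
  shows "lookup f (arrow Q b) = (if b = a then 1 else 0)"
proof -
  let ?g = "\<Sum>p \<in> {p \<in> keys f. path_length p = 1}. single p (lookup f p)"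
  have "path_class Q I (arrow Q a) \<in> graded_part Q I 1"
    unfolding graded_part_def path_span_def
    using arrow_in_basis[OF a] by (auto simp: path_elem_def arrow_def path_length_def)
  then have "degree_component Q I 1 (coset Q I f) = path_class Q I (arrow Q a)"
    using \<phi> f(2) unfolding Aut0_def by force
  then have eq: "coset Q I ?g = path_class Q I (arrow Q a)"
    by (simp add: degree_component_def coords_coset[OF f(1)])
  have "keys ?g \<subseteq> basis_paths Q I"
    by (rule keys_sum_subset) (use f(1) in auto)
  then have "?g = coords Q I (coset Q I ?g)" by (rule coords_coset[symmetric])
  also have "\<dots> = path_elem (arrow Q a)"
    unfolding eq by (rule coords_coset[OF keys_path_elem[OF arrow_in_basis[OF a]]])
  finally have "?g = path_elem (arrow Q a)" .
  moreover have "lookup ?g (arrow Q b) = lookup f (arrow Q b)"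
  proof -
    have "lookup ?g (arrow Q b) =
      (\<Sum>p \<in> {p \<in> keys f. path_length p = 1}. if p = arrow Q b then lookup f p else 0)"
      unfolding lookup_sum by (intro sum.cong) (simp_all add: lookup_single when_def)
    then show ?thesis by (simp add: in_keys_iff arrow_def path_length_def)
  qed
  ultimately show ?thesis
    by (auto simp: path_elem_def arrow_def lookup_single when_def)
qed

text \<open>
  The values of the derivation have no coordinates at arrows, since their paths are longer.
\<close>

lemma quot_arrow_subst_square:
  assumes Y: "\<And>a. a \<in> arcs Q \<Longrightarrow> keys (Y a) \<subseteq> {p \<in> paths Q. path_length p > 1}"
    and x: "x \<in> carrier A"
  shows "quot_arrow_subst Y (quot_arrow_subst Y x) = \<zero>\<^bsub>A\<^esub>"
proof -
  obtain f where f: "keys f \<subseteq> paths Q" "x = coset Q I f" using x by (rule quot_carrierE)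
  have keys: "keys (arrow_subst Y f) \<subseteq> {p \<in> paths Q. path_length p > 1}"
    by (rule keys_arrow_subst[OF Y])
  have "lookup (arrow_subst Y f) (arrow Q a) = 0" for a
    using keys by (auto simp: in_keys_iff arrow_def path_length_def)
  then have "arrow_subst Y (arrow_subst Y f) = 0" unfolding arrow_subst_def[of Y "arrow_subst Y f"] by simp
  moreover have "keys (arrow_subst Y f) \<subseteq> paths Q" using keys by auto
  ultimately show ?thesis using f by (simp add: quot_arrow_subst_coset quot_zero)
qed

end

theorem corollary4p7:
  fixes Q :: "('v, 'e) pre_digraph"
    and I :: "(('v, 'e) path \<Rightarrow>\<^sub>0 'k::field) set"
    and \<phi> :: "(('v, 'e) path \<Rightarrow>\<^sub>0 'k) set \<Rightarrow> (('v, 'e) path \<Rightarrow>\<^sub>0 'k) set"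
    and y :: "'e \<Rightarrow> (('v, 'e) path \<Rightarrow>\<^sub>0 'k) set"
  assumes "string_algebra Q I \<or> locally_string_algebra Q I"
    and "alg_iso (quot_algebra Q I) (polynomial_algebra :: ('k, 'k poly) module) = {}"
    and "\<phi> \<in> Aut0 Q I"
    and "\<And>\<alpha>. \<alpha> \<in> arcs Q \<Longrightarrow> y \<alpha> \<in> graded_part_gt Q I 1"
    and "\<And>\<alpha>. \<alpha> \<in> arcs Q \<Longrightarrow>
           y \<alpha> \<in> path_span Q I {p. maximal_path Q I p \<and> parallel Q p (arrow Q \<alpha>)}"
    and "\<And>\<alpha>. \<alpha> \<in> arcs Q \<Longrightarrow>
           \<phi> (path_class Q I (arrow Q \<alpha>)) \<in>
             (Idl\<^bsub>quot_algebra Q I\<^esub> {path_class Q I (arrow Q \<alpha>)}) +>\<^bsub>quot_algebra Q I\<^esub> y \<alpha>"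
  shows "let A = quot_algebra Q I;
             \<delta> = (\<lambda>x. \<ominus>\<^bsub>A\<^esub> (\<Oplus>\<^bsub>A\<^esub> \<alpha> \<in> arcs Q. elem_derivation Q I \<alpha> (y \<alpha>) x))
         in type_II Q I \<delta> \<and> locally_nilpotent A \<delta> \<and>
            (\<forall>\<alpha> \<in> arcs Q.
               (deriv_exp A \<delta> \<circ> \<phi>) (path_class Q I (arrow Q \<alpha>)) \<in>
                 Idl\<^bsub>A\<^esub> {path_class Q I (arrow Q \<alpha>)})"
proof -
  have "quiver Q" "string_relations Q I"
    using assms(1) by (auto simp: string_algebra_def locally_string_algebra_def)
  then have Q: "fin_digraph Q" and "\<exists>R \<subseteq> {p \<in> paths Q. path_length p \<ge> 2}. I = Idl\<^bsub>path_algebra Q\<^esub> (path_elem ` R)"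
    unfolding quiver_def string_relations_def by blast+
  then interpret monomial_quotient Q I
    using monomial_quotient_Idl[OF Q] by blast
  define \<delta> where "\<delta> = (\<lambda>x. \<ominus>\<^bsub>A\<^esub> (\<Oplus>\<^bsub>A\<^esub> \<alpha> \<in> arcs Q. elem_derivation Q I \<alpha> (y \<alpha>) x))"
  define Y where "Y a = coords Q I (y a)" for a
  have Y: "keys (Y a) \<subseteq> maximal_parallel a \<and>
      keys (Y a) \<subseteq> {p \<in> basis_paths Q I. path_length p > 1} \<and> y a = coset Q I (Y a)"
    if a: "a \<in> arcs Q" for a
  proof -
    \<comment> \<open>The two hypotheses provide two representatives of \<open>y a\<close>; uniqueness of coordinates makes them
      the same combination of paths.\<close>
    obtain f where f: "keys f \<subseteq> maximal_parallel a" "y a = coset Q I f"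
      using assms(5)[OF a] by (auto simp: path_span_def maximal_parallel_def)
    obtain g where g: "keys g \<subseteq> {p \<in> basis_paths Q I. path_length p > 1}" "y a = coset Q I g"
      using assms(4)[OF a] by (auto simp: path_span_def graded_part_gt_def)
    have "Y a = f" unfolding Y_def f(2) using f(1) maximal_parallel_subset by (intro coords_coset) blast
    moreover have "Y a = g" unfolding Y_def g(2) using g(1) by (intro coords_coset) blast
    ultimately show ?thesis using f g by auto
  qed
  \<comment> \<open>The sign of \<open>\<delta>\<close> is absorbed into the combinations, as the definition of type II has none.\<close>
  define Y' where "Y' a = - Y a" for a
  have Y': "keys (Y' a) = keys (Y a)" for a by (simp add: Y'_def)
  have max: "keys (Y' a) \<subseteq> maximal_parallel a" if "a \<in> arcs Q" for a
    using Y[OF that] by (simp add: Y')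
  have long: "keys (Y' a) \<subseteq> {p \<in> paths Q. path_length p > 1}" if "a \<in> arcs Q" for a
    using Y[OF that] basis_paths_subset by (auto simp: Y')
  have \<delta>: "\<delta> x = quot_arrow_subst Y' x" if x: "x \<in> carrier A" for x
  proof -
    obtain f where f: "keys f \<subseteq> paths Q" "x = coset Q I f" using x by (rule quot_carrierE)
    have "arrow_subst Y' f = - arrow_subst Y f"
      unfolding arrow_subst_def sum_negf[symmetric] Y'_def
      by (intro sum.cong refl poly_mapping_eqI) (simp add: lookup_scale)
    moreover have "keys (arrow_subst Y f) \<subseteq> paths Q"
      by (rule keys_arrow_subst) (use Y basis_paths_subset in blast)
    ultimately show ?thesis
      using sum_elem_derivation_maximal[of Y y x] Y x f
      by (simp add: \<delta>_def quot_arrow_subst_coset coset_minus)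
  qed
  have D: "derivation A (quot_arrow_subst Y')" by (rule quot_arrow_subst_derivation[OF max])
  then have D_closed: "quot_arrow_subst Y' x \<in> carrier A" if "x \<in> carrier A" for x
    using that by (auto simp: derivation_def)
  then have \<delta>_closed: "\<delta> x \<in> carrier A" if "x \<in> carrier A" for x
    using that by (simp add: \<delta>)
  have square: "\<delta> (\<delta> x) = \<zero>\<^bsub>A\<^esub>" if "x \<in> carrier A" for x
    using quot_arrow_subst_square[of Y' x, OF long that] that D_closed by (simp add: \<delta>)
  have zero: "\<delta> \<zero>\<^bsub>A\<^esub> = \<zero>\<^bsub>A\<^esub>"
    by (simp add: \<delta>) (simp add: quot_zero quot_arrow_subst_coset arrow_subst_def)
  have "derivation A \<delta>"
    using D unfolding derivation_def by (simp add: \<delta> quot_smult_closed Pi_def)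
  moreover have "\<delta> x = (\<Oplus>\<^bsub>A\<^esub> a \<in> arcs Q. elem_derivation Q I a (coset Q I (Y' a)) x)" if "x \<in> carrier A" for x
    using sum_elem_derivation_maximal[of Y' "\<lambda>a. coset Q I (Y' a)" x] max that by (simp add: \<delta>)
  moreover have "coset Q I (Y' a) \<in> graded_part_gt Q I 1" if "a \<in> arcs Q" for a
    using Y[OF that] by (auto simp: graded_part_gt_def path_span_def Y')
  moreover have "coset Q I (Y' a) \<in> path_span Q I {p. left_maximal Q I p \<and> derivation_pair Q I a p}" if "a \<in> arcs Q" for a
  proof -
    have "maximal_parallel a \<subseteq> {p. left_maximal Q I p \<and> derivation_pair Q I a p}"
      by (auto simp: maximal_parallel_def derivation_pair_def maximal_path_def left_maximal_def)
    then show ?thesis using max[OF that] by (auto simp: path_span_def)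
  qed
  ultimately have "type_II Q I \<delta>"
    unfolding type_II_def by (intro conjI exI[of _ "\<lambda>a. coset Q I (Y' a)"]) auto
  moreover have "locally_nilpotent A \<delta>"
    unfolding locally_nilpotent_def by (intro ballI exI[of _ 2]) (simp add: square numeral_2_eq_2)
  moreover have "(deriv_exp A \<delta> \<circ> \<phi>) (path_class Q I (arrow Q a)) \<in> Idl\<^bsub>A\<^esub> {path_class Q I (arrow Q a)}"
    if a: "a \<in> arcs Q" for a
  proof -
    let ?J = "Idl\<^bsub>A\<^esub> {path_class Q I (arrow Q a)}"
    have "path_class Q I (arrow Q a) \<in> carrier A"
      by (intro coset_in_carrier keys_path_elem arrow_paths a)
    then have J: "ideal ?J A" by (intro A.genideal_ideal) simp
    have y_carrier: "y a \<in> carrier A"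
      using Y[OF a] basis_paths_subset by (auto intro!: coset_in_carrier)
    obtain i where i: "i \<in> ?J" "\<phi> (path_class Q I (arrow Q a)) = i \<oplus>\<^bsub>A\<^esub> y a"
      using assms(6)[OF a] by (auto simp: a_r_coset_def')
    have i_carrier: "i \<in> carrier A" using ideal.Icarr[OF J i(1)] .
    then have \<phi>_carrier: "\<phi> (path_class Q I (arrow Q a)) \<in> carrier A" using i y_carrier by simp
    then obtain f where f: "keys f \<subseteq> basis_paths Q I" "\<phi> (path_class Q I (arrow Q a)) = coset Q I f"
      by (rule quot_carrier_basisE)
    have "arrow_subst Y' f = (\<Sum>b\<in>arcs Q. if b = a then Y' b else 0)"
      unfolding arrow_subst_def
      by (intro sum.cong refl poly_mapping_eqI) (simp add: lookup_scale degree_one_coefficients[OF assms(3) a f])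
    then have "arrow_subst Y' f = - Y a" using a finite_arcs by (simp add: Y'_def)
    moreover have "keys (Y a) \<subseteq> paths Q" "keys f \<subseteq> paths Q" "y a = coset Q I (Y a)"
      using f(1) Y[OF a] basis_paths_subset by blast+
    ultimately have "\<delta> (\<phi> (path_class Q I (arrow Q a))) = \<ominus>\<^bsub>A\<^esub> y a"
      unfolding f(2) by (simp add: \<delta> coset_in_carrier quot_arrow_subst_coset coset_minus)
    then have "deriv_exp A \<delta> (\<phi> (path_class Q I (arrow Q a))) = i \<oplus>\<^bsub>A\<^esub> y a \<oplus>\<^bsub>A\<^esub> \<ominus>\<^bsub>A\<^esub> y a"
      using deriv_exp_square_zero[of \<delta>, OF \<delta>_closed square zero \<phi>_carrier] i(2) by simp
    also have "\<dots> = i" using i_carrier y_carrier by (simp add: A.a_assoc A.r_neg)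
    finally show ?thesis using i(1) by simp
  qed
  ultimately show ?thesis unfolding Let_def \<delta>_def by blast
qed

end
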